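(* Let $A$ be a unital commutative $\mathbb R$-algebra and $G$ a set of generators for $A$. Let $(\gamma_a)_{a\in G}$ and $(\delta_a)_{a\in G}$ be families of positive real numbers. For a function $L:A\to\mathbb R$ the following conditions are equivalent: (i) $L$ is a linear positive semidefinite functional and $L(a^{2n})\le\gamma_a\delta_a^{2n}$ for all $n\in\mathbb N$ and $a\in G$; (ii) there is a positive Radon measure $\mu$ on $K$ such that $L(a)=\int_K\alpha(a)\,d\mu(\alpha)$ for all $a\in A$, where $$K=\{\alpha\in X(A):|\alpha(a)|\le\delta_a\text{ for all }a\in G\}.$$
   Context: $A$ is a unital commutative $\mathbb R$-algebra and $X(A)$ is the set of all (unital) $\mathbb R$-algebra homomorphisms $A\to\mathbb R$, assumed non-empty and endowed with the topology of pointwise convergence. $\mathbb N=\{1,2,\dots\}$. A linear functional $L:A\to\mathbb R$ is positive semidefinite if $L(a^2)\ge 0$ for all $a\in A$. Generators means generators of $A$ as a unital $\mathbb R$-algebra.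
   Formalization: The family (γ_a) is not fixed in advance: condition (i) is read as "for some positive family (γ_a)"; with γ prescribed, (ii)⇒(i) fails, e.g. A=R, G={1}, γ_1=δ_1=1, L(x)=2x. *)

theory Defs
  imports "HOL-Analysis.Analysis"
begin

definition real_subalgebra :: "'a::real_algebra_1 set \<Rightarrow> bool" where
  "real_subalgebra S \<longleftrightarrow> subspace S \<and> 1 \<in> S \<and> (\<forall>x\<in>S. \<forall>y\<in>S. x * y \<in> S)"

definition generates_algebra :: "'a::real_algebra_1 set \<Rightarrow> bool" where
  "generates_algebra G \<longleftrightarrow> real_subalgebra hull G = UNIV"

(* The function type carries the product topology, so the character space, as a subset
   of 'a => real, has the topology of pointwise convergence as its subspace topology. *)
definition character_space :: "('a::real_algebra_1 \<Rightarrow> real) set" where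
  "character_space =
     {\<alpha>. linear \<alpha> \<and> \<alpha> 1 = 1 \<and> (\<forall>a b. \<alpha> (a * b) = \<alpha> a * \<alpha> b)}"

definition psd_functional :: "('a::real_algebra_1 \<Rightarrow> real) \<Rightarrow> bool" where
  "psd_functional L \<longleftrightarrow> (\<forall>a. L (a ^ 2) \<ge> 0)"

(* For subspaces S of a Hausdorff space (as real-valued functions with the product topology
   are): a locally finite Borel measure on S that is inner regular with respect to compact
   sets.  Positivity is built into the type of measures.  The trace of the Borel
   sigma-algebra on S is the Borel sigma-algebra of the subspace topology, also when S is
   not a Borel set; in particular the condition on the sets gives space M = S.  A subset of
   S is compact in the subspace topology iff it is compact in the ambient one. *)
definition radon_measure_on :: "'b::topological_space set \<Rightarrow> 'b measure \<Rightarrow> bool" where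
  "radon_measure_on S M \<longleftrightarrow>
     sets M = sets (restrict_space borel S) \<and>
     (\<forall>x\<in>S. \<exists>U. open U \<and> x \<in> U \<and> emeasure M (U \<inter> S) < \<infinity>) \<and>
     (\<forall>B\<in>sets M. emeasure M B = (SUP C\<in>{C. C \<subseteq> B \<and> compact C}. emeasure M C))"

(* In the theorem the factors \<gamma> are quantified existentially inside the growth condition:
   a representing measure on K does not bound L by factors prescribed in advance.  On the
   algebra of reals take G = {1}, \<gamma> 1 = \<delta> 1 = 1 and L x = 2 * x; this L is represented by
   twice the Dirac measure at the identity, but L (1 ^ 2) = 2. *)

end

theory Submission
  imports Defs
begin

text \<open>
  That a representing measure on \<open>K\<close> yields a positive functional with the stated growth is a direct
  estimate under the integral. The substance is the converse, which has three ingredients.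

  The first is positivity: if \<open>L\<close> satisfies the moment conditions and \<open>a\<close> is nonnegative on \<open>K\<close>, then
  \<open>L a \<ge> 0\<close> (\<open>moment_bounded_nonneg\<close>). Consider all elements \<open>t\<close> such that \<open>x \<mapsto> \<phi> (t * x)\<close> satisfies
  the moment conditions whenever \<open>\<phi>\<close> does. They form a semiring on which \<open>L\<close> is nonnegative. It contains
  the squares, and it contains \<open>(\<delta> g)\<^sup>2 - g\<^sup>2\<close> for every generator \<open>g\<close>, because the normalised even
  moments of \<open>g\<close> form a bounded convex sequence, which cannot increase (\<open>moment_bounded_square_le\<close>).
  Consequently it contains \<open>\<delta> g - g\<close> and \<open>\<delta> g + g\<close>, and as the \<open>g\<close> generate the algebra, every element is
  bounded by a constant modulo the semiring. For such an archimedean semiring the theorem of Krivine and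
  Kadison-Dubois (\<open>separating_character\<close>) provides, for every element outside it, a character that is
  nonnegative on the semiring and nonpositive at the element. Nonnegativity at \<open>\<delta> g - g\<close> and
  \<open>\<delta> g + g\<close> says exactly that the character belongs to \<open>K\<close>.

  The second is that \<open>K\<close> is compact (\<open>compact_bounded_characters\<close>) and that the algebra, acting on \<open>K\<close> by
  evaluation, is uniformly dense in the continuous functions by the theorem of Stone and Weierstrass. By
  positivity \<open>L\<close> extends to a positive functional on them (\<open>extend_to_continuous_functions\<close>).

  The third is the theorem of Riesz, Markov and Kakutani on a compact Hausdorff space, with inner
  regularity of the measure on all Borel sets (\<open>representing_measure_inner_regular\<close>,
  \<open>integral_representing_measure\<close>). No countability is available, as the algebra may have any number of
  generators; the measure is obtained from an outer measure by the criterion of Caratheodory.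
\<close>

section \<open>Characters of archimedean semirings\<close>

text \<open>The positive cone of the representation theorem. Since every element is dominated by a real
constant, the values at a fixed element of all linear functionals that are nonnegative on the semiring
and normalised at 1 lie in one bounded interval; this takes the place of a norm.\<close>

locale archimedean_semiring =
  fixes T :: "'a::{real_algebra_1, comm_ring_1} set"
  assumes add: "x \<in> T \<Longrightarrow> y \<in> T \<Longrightarrow> x + y \<in> T"
    and mult: "x \<in> T \<Longrightarrow> y \<in> T \<Longrightarrow> x * y \<in> T"
    and nonneg: "0 \<le> r \<Longrightarrow> of_real r \<in> T"
    and archimedean: "\<exists>r. of_real r - x \<in> T"
begin

lemma bounded_both:
  obtains r where "r > 0" "of_real r - x \<in> T" "of_real r + x \<in> T"
proof -
  obtain p q where pq: "of_real p - x \<in> T" "of_real q - (- x) \<in> T"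
    using archimedean by metis
  define r where "r = \<bar>p\<bar> + \<bar>q\<bar> + 1"
  have "of_real r - x = (of_real p - x) + of_real (r - p)"
    "of_real r + x = (of_real q - (- x)) + of_real (r - q)"
    by auto
  moreover have "r - p \<ge> 0" "r - q \<ge> 0" "r > 0"
    unfolding r_def by linarith+
  ultimately show thesis
    using that pq add nonneg by metis
qed

text \<open>If a semiring element times \<open>a\<close> is at least 1, then \<open>a\<close> should be positive wherever the semiring
is, and the archimedean property turns this into membership. Some translate \<open>a + r\<close> lies in \<open>T\<close>, and
with \<open>k - s \<in> T\<close> the product \<open>(k - s) * (a + r)\<close> shows that \<open>r\<close> may be lowered by \<open>1/k\<close> as long as
it is nonnegative. Finitely many steps make \<open>r \<le> 0\<close>.\<close>

lemma mem_if_multiple_ge_one: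
  assumes s: "s \<in> T" and t: "t \<in> T" and eq: "s * a = 1 + t"
  shows "a \<in> T"
proof -
  obtain k where k: "k > 0" "of_real k - s \<in> T"
    using bounded_both by metis
  obtain r where r: "of_real r + a \<in> T"
    using bounded_both by metis
  have step: "of_real (q - 1/k) + a \<in> T" if q: "q \<ge> 0" "of_real q + a \<in> T" for q
  proof -
    have "of_real k * (of_real (q - 1/k) + a) = of_real (k*q) - 1 + of_real k * a"
      using k(1) by (simp add: algebra_simps flip: of_real_mult)
    also have "\<dots> = (of_real k - s) * (of_real q + a) + s * of_real q + t"
      using eq by (simp add: algebra_simps)
    also have "\<dots> \<in> T"
      by (rule add[OF add[OF mult[OF k(2) q(2)] mult[OF s nonneg[OF q(1)]]] t])
    finally have m: "of_real k * (of_real (q - 1/k) + a) \<in> T" .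
    have "of_real (1/k) * (of_real k * (of_real (q - 1/k) + a)) \<in> T"
      by (rule mult[OF nonneg m]) (use k(1) in simp)
    moreover have "of_real (1/k) * (of_real k * x) = x" for x :: 'a
      using k(1) by (simp flip: mult.assoc of_real_mult)
    ultimately show ?thesis
      by metis
  qed
  have iterate: "\<exists>q. q \<le> max 0 (r - n * (1/k)) \<and> of_real q + a \<in> T" for n :: nat
  proof (induction n)
    case 0
    then show ?case
      using r by (intro exI[of _ r]) auto
  next
    case (Suc n)
    then obtain q where q: "q \<le> max 0 (r - n * (1/k))" "of_real q + a \<in> T"
      by blast
    show ?case
    proof (cases "q \<le> 0")
      case True
      then show ?thesis
        using q by (intro exI[of _ q]) auto
    next
      case False
      then have "q - 1/k \<le> max 0 (r - Suc n * (1/k))"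
        using q(1) by (simp add: max_def distrib_right add_divide_distrib split: if_splits)
      then show ?thesis
        using step[of q] False q by auto
    qed
  qed
  obtain n :: nat where "n > r / (1/k)"
    using reals_Archimedean2 by blast
  then have "r - n * (1/k) < 0"
    using k(1) by (simp add: field_simps)
  then obtain q where q: "q \<le> 0" "of_real q + a \<in> T"
    using iterate[of n] by auto
  then have "(of_real q + a) + of_real (- q) \<in> T"
    by (intro add[OF q(2) nonneg]) simp
  then show ?thesis
    by simp
qed

text \<open>Maximal objects are sought among modules over \<open>T\<close> instead of among semirings: adjoining an
element to a module has the simple description \<open>P + T a\<close>.\<close>

definition semimodule :: "'a set \<Rightarrow> bool" where
  "semimodule P \<longleftrightarrow> T \<subseteq> P \<and> (\<forall>x\<in>P. \<forall>y\<in>P. x + y \<in> P) \<and> (\<forall>t\<in>T. \<forall>x\<in>P. t * x \<in> P)"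

lemma semimoduleD:
  assumes "semimodule P"
  shows "t \<in> T \<Longrightarrow> t \<in> P" "x \<in> P \<Longrightarrow> y \<in> P \<Longrightarrow> x + y \<in> P"
    "t \<in> T \<Longrightarrow> x \<in> P \<Longrightarrow> t * x \<in> P"
  using assms unfolding semimodule_def by auto

lemma semimodule_self: "semimodule T"
  using add mult unfolding semimodule_def by auto

lemma semimodule_adjoin:
  assumes "semimodule P"
  shows "semimodule {p + t * a |p t. p \<in> P \<and> t \<in> T}"
    and "P \<subseteq> {p + t * a |p t. p \<in> P \<and> t \<in> T}"
    and "a \<in> {p + t * a |p t. p \<in> P \<and> t \<in> T}"
proof -
  let ?Q = "{p + t * a |p t. p \<in> P \<and> t \<in> T}"
  note P = semimoduleD[OF assms]
  have zero_one: "0 \<in> T" "1 \<in> T"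
    using nonneg[of 0] nonneg[of 1] by auto
  show sub: "P \<subseteq> {p + t * a |p t. p \<in> P \<and> t \<in> T}"
    using zero_one by force
  have "a = 0 + 1 * a" by simp
  then show "a \<in> {p + t * a |p t. p \<in> P \<and> t \<in> T}"
    using zero_one P by blast
  have eq: "(p + t * a) + (p' + t' * a) = (p + p') + (t + t') * a"
    "s * (p + t * a) = s * p + (s * t) * a" for p p' t t' s
    by (auto simp: algebra_simps)
  have "x + y \<in> ?Q" if "x \<in> ?Q" "y \<in> ?Q" for x y
  proof -
    obtain p t p' t' where "x = p + t * a" "y = p' + t' * a" "p \<in> P" "p' \<in> P" "t \<in> T" "t' \<in> T"
      using \<open>x \<in> ?Q\<close> \<open>y \<in> ?Q\<close> by blast
    then show ?thesis
      using eq(1)[of p t p' t'] P(2)[of p p'] add[of t t'] by blast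
  qed
  moreover have "s * x \<in> ?Q" if "s \<in> T" "x \<in> ?Q" for s x
  proof -
    obtain p t where "x = p + t * a" "p \<in> P" "t \<in> T"
      using \<open>x \<in> ?Q\<close> by blast
    then show ?thesis
      using eq(2)[of s p t] P(3)[of s p] mult[of s t] \<open>s \<in> T\<close> by blast
  qed
  ultimately show "semimodule ?Q"
    unfolding semimodule_def using P(1) sub by blast
qed

lemma maximal_proper_semimodule:
  assumes "semimodule P" "- 1 \<notin> P"
  obtains M where "semimodule M" "- 1 \<notin> M" "P \<subseteq> M"
    "\<And>Q. semimodule Q \<Longrightarrow> - 1 \<notin> Q \<Longrightarrow> M \<subseteq> Q \<Longrightarrow> Q = M"
proof -
  let ?A = "{Q. semimodule Q \<and> - 1 \<notin> Q \<and> P \<subseteq> Q}"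
  have "\<exists>M\<in>?A. \<forall>X\<in>?A. M \<subseteq> X \<longrightarrow> X = M"
  proof (rule subset_Zorn_nonempty)
    show "?A \<noteq> {}"
      using assms by blast
  next
    fix C
    assume C: "C \<noteq> {}" "subset.chain ?A C"
    then have mem: "semimodule Q" "- 1 \<notin> Q" "P \<subseteq> Q" if "Q \<in> C" for Q
      using that unfolding subset.chain_def by auto
    have dir: "Q \<subseteq> Q' \<or> Q' \<subseteq> Q" if "Q \<in> C" "Q' \<in> C" for Q Q'
      using C(2) that unfolding subset_chain_def by blast
    have "x + y \<in> \<Union>C" if "x \<in> \<Union>C" "y \<in> \<Union>C" for x y
    proof -
      obtain Q Q' where "Q \<in> C" "Q' \<in> C" "x \<in> Q" "y \<in> Q'"
        using \<open>x \<in> \<Union>C\<close> \<open>y \<in> \<Union>C\<close> by blast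
      with dir[of Q Q'] show ?thesis
        using semimoduleD(2)[OF mem(1)] by blast
    qed
    moreover have "T \<subseteq> \<Union>C"
      using C(1) semimoduleD(1)[OF mem(1)] by blast
    moreover have "t * x \<in> \<Union>C" if "t \<in> T" "x \<in> \<Union>C" for t x
      using that semimoduleD(3)[OF mem(1)] by blast
    ultimately have "semimodule (\<Union>C)"
      unfolding semimodule_def by blast
    then show "\<Union>C \<in> ?A"
      using mem C(1) by blast
  qed
  then show thesis
    using that by auto
qed

text \<open>If neither \<open>a\<close> nor \<open>- a\<close> could be adjoined, then \<open>- 1 = p + t a\<close> and \<open>- 1 = q - s a\<close>. Eliminating
\<open>a\<close> from the two equations gives \<open>- t \<in> M\<close>. As \<open>a + r \<in> T\<close> for some constant \<open>r\<close>, the element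
\<open>t a = t (a + r) + r (- t)\<close> then lies in \<open>M\<close>, and hence so does \<open>- 1\<close>.\<close>

lemma maximal_semimodule_total:
  assumes M: "semimodule M" "- 1 \<notin> M"
    and max: "\<And>Q. semimodule Q \<Longrightarrow> - 1 \<notin> Q \<Longrightarrow> M \<subseteq> Q \<Longrightarrow> Q = M"
  shows "a \<in> M \<or> - a \<in> M"
proof (rule ccontr)
  note D = semimoduleD[OF M(1)]
  have ex: "\<exists>p\<in>M. \<exists>t\<in>T. - 1 = p + t * b" if "b \<notin> M" for b
    using max[OF semimodule_adjoin(1)[OF M(1), of b] _ semimodule_adjoin(2)[OF M(1), of b]]
      semimodule_adjoin(3)[OF M(1), of b] that by blast
  assume "\<not> (a \<in> M \<or> - a \<in> M)"
  then obtain p t q s where *: "p \<in> M" "t \<in> T" "- 1 = p + t * a"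
    "q \<in> M" "s \<in> T" "- 1 = q + s * (- a)"
    using ex[of a] ex[of "- a"] by blast
  have sp: "s * (- 1) = s * (p + t * a)" and tq: "t * (- 1) = t * (q + s * (- a))"
    using * by metis+
  have "- s - t = s * p + t * q"
    using sp tq by (simp add: algebra_simps)
  moreover have "s * p + t * q \<in> M"
    using * D by blast
  ultimately have "(- s - t) + s \<in> M"
    using D(1)[OF \<open>s \<in> T\<close>] D(2) by metis
  then have mt: "- t \<in> M"
    by simp
  obtain r where r: "r > 0" "of_real r + a \<in> T"
    using bounded_both by metis
  have "- 1 = p + (of_real r + a) * t + of_real r * (- t)"
    using *(3) by (simp add: algebra_simps)
  moreover have "p + (of_real r + a) * t + of_real r * (- t) \<in> M"
    using D(2)[OF D(2)[OF *(1) D(3)[OF r(2) D(1)[OF *(2)]]] D(3)[OF nonneg mt]] r(1) by simp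
  ultimately show False
    using M(2) by metis
qed

text \<open>A total module cuts the reals at every element \<open>a\<close>: the constants \<open>r\<close> with \<open>r - a \<in> M\<close> lie above
those with \<open>a - r \<in> M\<close>, and \<open>\<alpha> a\<close> is the cut. Linearity is a comparison of cuts. For
multiplicativity, \<open>M\<close> being a module over \<open>T\<close> makes the kernel of \<open>\<alpha>\<close> stable under multiplication by
\<open>T\<close>, and every element is a difference of an element of \<open>T\<close> and a constant, so that the kernel is an
ideal.\<close>

lemma character_of_total_semimodule:
  assumes M: "semimodule M" "- 1 \<notin> M" and total: "\<And>a. a \<in> M \<or> - a \<in> M"
  obtains \<alpha> where "\<alpha> \<in> character_space" "\<And>x. x \<in> M \<Longrightarrow> \<alpha> x \<ge> 0"
proof -
  note D = semimoduleD[OF M(1)]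
  have scale: "of_real r * x \<in> M" if "r \<ge> 0" "x \<in> M" for r x
    using D(3)[OF nonneg] that by blast
  have neg: "c \<ge> 0" if "of_real c \<in> M" for c
  proof (rule ccontr)
    assume "\<not> c \<ge> 0"
    then have "of_real (- 1 / c) * of_real c \<in> M"
      using that by (intro scale) (auto simp: divide_nonneg_neg)
    moreover have "of_real (- 1 / c) * of_real c = (of_real (- 1 / c * c) :: 'a)"
      by (rule of_real_mult[symmetric])
    moreover have "- 1 / c * c = - 1"
      using \<open>\<not> c \<ge> 0\<close> by simp
    ultimately show False
      using M(2) by simp
  qed
  \<comment> \<open>The values are characterised up to every positive error because the cut itself need not belong
    to either side.\<close>
  define is_value where "is_value a c \<longleftrightarrow>
    (\<forall>e>0. of_real (c + e) - a \<in> M \<and> a - of_real (c - e) \<in> M)" for a c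
  have unique: "c \<le> d" if "is_value a c" "is_value a d" for a c d
  proof (rule field_le_epsilon)
    fix e :: real assume "e > 0"
    then have "(of_real (d + e/2) - a) + (a - of_real (c - e/2)) \<in> M"
      using that unfolding is_value_def by (intro D(2)) auto
    also have "(of_real (d + e/2) - a) + (a - of_real (c - e/2)) = of_real ((d + e/2) - (c - e/2))"
      by (simp only: of_real_diff) simp
    finally have "0 \<le> (d + e/2) - (c - e/2)"
      by (rule neg)
    then show "c \<le> d + e"
      by simp
  qed
  have "\<exists>c. is_value a c" for a
  proof -
    define S where "S = {r. of_real r - a \<in> M}"
    obtain k where k: "of_real k - a \<in> T" "of_real k + a \<in> T"
      using bounded_both by metis
    have "S \<noteq> {}"
      using k D(1) unfolding S_def by blast
    have lower: "- k \<le> r" if "r \<in> S" for r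
    proof -
      have "(of_real r - a) + (of_real k + a) \<in> M"
        using that k D unfolding S_def by blast
      also have "(of_real r - a) + (of_real k + a) = of_real (r + k)"
        by simp
      finally have "r + k \<ge> 0"
        by (rule neg)
      then show ?thesis
        by simp
    qed
    then have bdd: "bdd_below S"
      by (meson bdd_below.I)
    have "of_real (Inf S + e) - a \<in> M \<and> a - of_real (Inf S - e) \<in> M" if "e > 0" for e
    proof
      obtain r where r: "r \<in> S" "r < Inf S + e"
        using cInf_lessD[OF \<open>S \<noteq> {}\<close>, of "Inf S + e"] \<open>e > 0\<close> by auto
      have "(of_real r - a) + of_real (Inf S + e - r) \<in> M"
        using r D(1)[OF nonneg[of "Inf S + e - r"]] by (intro D(2)) (auto simp: S_def)
      then show "of_real (Inf S + e) - a \<in> M"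
        by simp
      have "Inf S - e \<notin> S"
        using cInf_lower[OF _ bdd, of "Inf S - e"] \<open>e > 0\<close> by auto
      then show "a - of_real (Inf S - e) \<in> M"
        using total[of "of_real (Inf S - e) - a"] unfolding S_def by auto
    qed
    then show ?thesis
      unfolding is_value_def by blast
  qed
  then obtain \<alpha> where value_\<alpha>: "\<And>a. is_value a (\<alpha> a)"
    by metis
  have \<alpha>_eqI: "\<alpha> a = c" if "is_value a c" for a c
    using unique[OF that value_\<alpha>] unique[OF value_\<alpha> that] by simp
  have \<alpha>_add: "\<alpha> (a + b) = \<alpha> a + \<alpha> b" for a b
  proof (rule \<alpha>_eqI, unfold is_value_def, intro allI impI)
    fix e :: real assume "e > 0"
    then have "e/2 > 0" by simp
    then have m: "of_real (\<alpha> a + e/2) - a \<in> M" "a - of_real (\<alpha> a - e/2) \<in> M"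
      "of_real (\<alpha> b + e/2) - b \<in> M" "b - of_real (\<alpha> b - e/2) \<in> M"
      using value_\<alpha> unfolding is_value_def by blast+
    have "\<alpha> a + \<alpha> b + e = (\<alpha> a + e/2) + (\<alpha> b + e/2)"
      "\<alpha> a + \<alpha> b - e = (\<alpha> a - e/2) + (\<alpha> b - e/2)"
      by simp_all
    then have "of_real (\<alpha> a + \<alpha> b + e) - (a + b) = (of_real (\<alpha> a + e/2) - a) + (of_real (\<alpha> b + e/2) - b)"
      "(a + b) - of_real (\<alpha> a + \<alpha> b - e) = (a - of_real (\<alpha> a - e/2)) + (b - of_real (\<alpha> b - e/2))"
      by (simp_all only: of_real_add add_diff_add)
    then show "of_real (\<alpha> a + \<alpha> b + e) - (a + b) \<in> M \<and> (a + b) - of_real (\<alpha> a + \<alpha> b - e) \<in> M"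
      using m D(2) by metis
  qed
  have \<alpha>_of_real: "\<alpha> (of_real c) = c" for c
    by (rule \<alpha>_eqI) (auto simp: is_value_def nonneg D(1))
  have \<alpha>_uminus: "\<alpha> (- a) = - \<alpha> a" for a
    using \<alpha>_add[of a "- a"] \<alpha>_of_real[of 0] by simp
  have \<alpha>_scale_pos: "\<alpha> (of_real r * a) = r * \<alpha> a" if "r > 0" for r a
  proof (rule \<alpha>_eqI, unfold is_value_def, intro allI impI)
    fix e :: real assume "e > 0"
    then have "e/r > 0" using that by simp
    then have m: "of_real r * (of_real (\<alpha> a + e/r) - a) \<in> M" "of_real r * (a - of_real (\<alpha> a - e/r)) \<in> M"
      using value_\<alpha>[of a] that unfolding is_value_def by (auto intro!: scale simp del: of_real_add of_real_diff)
    have "r * (\<alpha> a + e/r) = r * \<alpha> a + e" "r * (\<alpha> a - e/r) = r * \<alpha> a - e"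
      using that by (simp_all add: field_simps)
    then show "of_real (r * \<alpha> a + e) - of_real r * a \<in> M \<and> of_real r * a - of_real (r * \<alpha> a - e) \<in> M"
      using m unfolding right_diff_distrib of_real_mult[symmetric] by simp
  qed
  have \<alpha>_scale: "\<alpha> (of_real r * a) = r * \<alpha> a" for r a
  proof (cases r "0 :: real" rule: linorder_cases)
    case less
    then show ?thesis
      using \<alpha>_scale_pos[of "- r" a] \<alpha>_uminus[of "of_real r * a"] by simp
  next
    case equal
    then show ?thesis
      using \<alpha>_of_real[of 0] by simp
  qed (rule \<alpha>_scale_pos)
  have \<alpha>_diff: "\<alpha> (a - b) = \<alpha> a - \<alpha> b" for a b
    using \<alpha>_add[of a "- b"] \<alpha>_uminus by simp
  have \<alpha>_nonneg: "\<alpha> x \<ge> 0" if "x \<in> M" for x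
  proof (rule field_le_epsilon)
    fix e :: real assume "e > 0"
    then have "(of_real (\<alpha> x + e) - x) + x \<in> M"
      using value_\<alpha> that D(2) unfolding is_value_def by blast
    then show "0 \<le> \<alpha> x + e"
      using neg by simp
  qed
  have kernel_T: "\<alpha> (t * x) = 0" if t: "t \<in> T" and x: "\<alpha> x = 0" for t x
  proof -
    have le: "0 \<le> e * \<alpha> t + \<alpha> (t * y)" if "\<alpha> y = 0" "e > 0" for y e
    proof -
      have "t * (y - of_real (- e)) \<in> M"
        using value_\<alpha>[of y] that unfolding is_value_def by (intro D(3)[OF t]) auto
      also have "t * (y - of_real (- e)) = of_real e * t + t * y"
        by (simp add: algebra_simps)
      finally show ?thesis
        by (metis \<alpha>_nonneg \<alpha>_add \<alpha>_scale)
    qed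
    have "0 \<le> \<alpha> (t * y)" if y: "\<alpha> y = 0" for y
    proof (rule field_le_epsilon)
      fix e :: real assume "e > 0"
      have "\<alpha> t \<ge> 0"
        using \<alpha>_nonneg D(1) t by blast
      then have "e / (\<alpha> t + 1) > 0" "e / (\<alpha> t + 1) * \<alpha> t \<le> e"
        using \<open>e > 0\<close> by (simp_all add: field_simps)
      then show "0 \<le> \<alpha> (t * y) + e"
        using le[OF y, of "e / (\<alpha> t + 1)"] by linarith
    qed
    from this[of x] this[of "- x"] show ?thesis
      using x \<alpha>_uminus by simp
  qed
  have kernel: "\<alpha> (b * x) = 0" if "\<alpha> x = 0" for b x
  proof -
    obtain k where k: "of_real k + b \<in> T"
      by (rule bounded_both)
    have "k * \<alpha> x + \<alpha> (b * x) = \<alpha> ((of_real k + b) * x)"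
      unfolding distrib_right \<alpha>_add \<alpha>_scale by (rule refl)
    also have "\<dots> = 0"
      by (rule kernel_T[OF k that])
    finally show ?thesis
      unfolding that by simp
  qed
  have "\<alpha> (a * b) = \<alpha> a * \<alpha> b" for a b
  proof -
    have "\<alpha> (b * (a - of_real (\<alpha> a))) = 0"
      by (rule kernel) (simp only: \<alpha>_diff \<alpha>_of_real diff_self)
    also have "b * (a - of_real (\<alpha> a)) = a * b - of_real (\<alpha> a) * b"
      by (simp add: algebra_simps)
    finally show ?thesis
      unfolding \<alpha>_diff \<alpha>_scale by simp
  qed
  moreover have "linear \<alpha>"
    using \<alpha>_add \<alpha>_scale by (auto intro!: linearI simp: scaleR_conv_of_real)
  moreover have "\<alpha> 1 = 1"
    using \<alpha>_of_real[of 1] by simp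
  ultimately have "\<alpha> \<in> character_space"
    unfolding character_space_def by blast
  then show thesis
    using that \<alpha>_nonneg by blast
qed

text \<open>The representation theorem of Krivine and Kadison-Dubois as a separation theorem. The module
generated by \<open>- a\<close> is proper, since otherwise \<open>t a = 1 + p\<close> would put \<open>a\<close> into \<open>T\<close>. A maximal proper
module above it is total, and its character is the one required.\<close>

theorem separating_character:
  assumes "a \<notin> T"
  obtains \<alpha> where "\<alpha> \<in> character_space" "\<And>t. t \<in> T \<Longrightarrow> \<alpha> t \<ge> 0" "\<alpha> a \<le> 0"
proof -
  let ?P = "{p + t * (- a) |p t. p \<in> T \<and> t \<in> T}"
  have "- 1 \<notin> ?P"
  proof
    assume "- 1 \<in> ?P"
    then obtain p t where "p \<in> T" "t \<in> T" "- 1 = p + t * (- a)"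
      by blast
    then have "t * a = - (- 1 - p)"
      by simp
    then have "t * a = 1 + p"
      by simp
    then show False
      using mem_if_multiple_ge_one \<open>p \<in> T\<close> \<open>t \<in> T\<close> assms by blast
  qed
  then obtain M where M: "semimodule M" "- 1 \<notin> M" "?P \<subseteq> M"
    "\<And>Q. semimodule Q \<Longrightarrow> - 1 \<notin> Q \<Longrightarrow> M \<subseteq> Q \<Longrightarrow> Q = M"
    by (rule maximal_proper_semimodule[OF semimodule_adjoin(1)[OF semimodule_self]]) blast
  obtain \<alpha> where \<alpha>: "\<alpha> \<in> character_space" "\<And>x. x \<in> M \<Longrightarrow> \<alpha> x \<ge> 0"
    using character_of_total_semimodule[OF M(1,2) maximal_semimodule_total[OF M(1,2,4)]] by blast
  have "- a \<in> M"
    using semimodule_adjoin(3)[OF semimodule_self] M(3) by blast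
  then have "\<alpha> a \<le> 0"
    using \<alpha> linear_neg[of \<alpha> a] unfolding character_space_def by force
  then show thesis
    using that \<alpha> semimoduleD(1)[OF M(1)] by blast
qed

end

section \<open>Functionals with bounded moments\<close>

lemma characterD:
  assumes "\<alpha> \<in> character_space"
  shows "linear \<alpha>" "\<alpha> 1 = 1" "\<alpha> (a * b) = \<alpha> a * \<alpha> b"
    "\<alpha> (of_real c) = c" "\<alpha> (a ^ n) = \<alpha> a ^ n"
proof -
  show *: "linear \<alpha>" "\<alpha> 1 = 1" "\<alpha> (a * b) = \<alpha> a * \<alpha> b" for a b
    using assms unfolding character_space_def by auto
  show "\<alpha> (of_real c) = c"
    using *(2) linear_scale[OF *(1), of c 1] by (simp add: of_real_def)
  show "\<alpha> (a ^ n) = \<alpha> a ^ n"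
    by (induction n) (auto simp: *)
qed

text \<open>The constant may depend on \<open>a\<close> and on the functional. This freedom is what makes the class of
these functionals stable under the multipliers defined next.\<close>

definition moment_bounded ::
    "'a::{real_algebra_1, comm_ring_1} set \<Rightarrow> ('a \<Rightarrow> real) \<Rightarrow> ('a \<Rightarrow> real) \<Rightarrow> bool" where
  "moment_bounded G \<delta> \<phi> \<longleftrightarrow> linear \<phi> \<and> psd_functional \<phi> \<and>
     (\<forall>a\<in>G. \<exists>\<gamma>. \<forall>n. \<phi> (a ^ (2 * n)) \<le> \<gamma> * \<delta> a ^ (2 * n))"

text \<open>The semiring to which the separation theorem is applied. Quantifying over all functionals of the
class at once makes closure under products immediate, whereas the cone of those \<open>t\<close> that work for one
given functional has no evident multiplicative structure.\<close>

definition bounded_multipliers ::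
    "'a::{real_algebra_1, comm_ring_1} set \<Rightarrow> ('a \<Rightarrow> real) \<Rightarrow> 'a set" where
  "bounded_multipliers G \<delta> =
     {t. \<forall>\<phi>. moment_bounded G \<delta> \<phi> \<longrightarrow> moment_bounded G \<delta> (\<lambda>x. \<phi> (t * x))}"

lemma moment_boundedE:
  assumes "moment_bounded G \<delta> \<phi>" "a \<in> G"
  obtains \<gamma> where "\<And>n. \<phi> (a ^ (2 * n)) \<le> \<gamma> * \<delta> a ^ (2 * n)"
  using assms unfolding moment_bounded_def by blast

lemma moment_bounded_nonneg_multiplier:
  assumes "moment_bounded G \<delta> \<phi>" "t \<in> bounded_multipliers G \<delta>"
  shows "\<phi> t \<ge> 0"
proof -
  have "psd_functional (\<lambda>x. \<phi> (t * x))"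
    using assms unfolding bounded_multipliers_def moment_bounded_def by blast
  from this[unfolded psd_functional_def, rule_format, of 1] show ?thesis
    by simp
qed

lemma linear_compose_mult:
  fixes \<phi> :: "'a::{real_algebra_1, comm_ring_1} \<Rightarrow> real"
  assumes "linear \<phi>"
  shows "linear (\<lambda>x. \<phi> (t * x))"
  using assms by (auto simp: linear_iff distrib_left)

lemma moment_bounded_add:
  assumes "moment_bounded G \<delta> \<phi>" "moment_bounded G \<delta> \<psi>"
  shows "moment_bounded G \<delta> (\<lambda>x. \<phi> x + \<psi> x)"
proof -
  have "\<exists>\<gamma>. \<forall>n. \<phi> (a ^ (2 * n)) + \<psi> (a ^ (2 * n)) \<le> \<gamma> * \<delta> a ^ (2 * n)" if "a \<in> G" for a
  proof -
    obtain p where "\<And>n. \<phi> (a ^ (2 * n)) \<le> p * \<delta> a ^ (2 * n)"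
      using assms(1) \<open>a \<in> G\<close> by (rule moment_boundedE) blast
    moreover obtain q where "\<And>n. \<psi> (a ^ (2 * n)) \<le> q * \<delta> a ^ (2 * n)"
      using assms(2) \<open>a \<in> G\<close> by (rule moment_boundedE) blast
    ultimately show ?thesis
      by (intro exI[of _ "p + q"]) (simp add: distrib_right add_mono)
  qed
  moreover have "linear (\<lambda>x. \<phi> x + \<psi> x)"
    using assms unfolding moment_bounded_def by (simp add: linear_compose_add)
  ultimately show ?thesis
    using assms unfolding moment_bounded_def psd_functional_def by auto
qed

lemma moment_bounded_scale:
  assumes "moment_bounded G \<delta> \<phi>" "r \<ge> 0"
  shows "moment_bounded G \<delta> (\<lambda>x. r * \<phi> x)"
proof -
  have "\<exists>\<gamma>. \<forall>n. r * \<phi> (a ^ (2 * n)) \<le> \<gamma> * \<delta> a ^ (2 * n)" if "a \<in> G" for a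
  proof -
    obtain p where "\<And>n. \<phi> (a ^ (2 * n)) \<le> p * \<delta> a ^ (2 * n)"
      using assms(1) \<open>a \<in> G\<close> by (rule moment_boundedE) blast
    then show ?thesis
      using assms(2) by (intro exI[of _ "r * p"]) (simp add: mult.assoc mult_left_mono)
  qed
  moreover have "linear (\<lambda>x. r * \<phi> x)"
    using assms(1) linear_compose_scale_right[of \<phi> r] unfolding moment_bounded_def by simp
  ultimately show ?thesis
    using assms unfolding moment_bounded_def psd_functional_def by auto
qed

lemma linear_of_real_mult:
  fixes \<phi> :: "'a::real_algebra_1 \<Rightarrow> real"
  assumes "linear \<phi>"
  shows "\<phi> (of_real r * x) = r * \<phi> x"
  using linear_scale[OF assms, of r x] by (simp add: scaleR_conv_of_real)

lemma bounded_multipliers_add: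
  assumes "s \<in> bounded_multipliers G \<delta>" "t \<in> bounded_multipliers G \<delta>"
  shows "s + t \<in> bounded_multipliers G \<delta>"
  unfolding bounded_multipliers_def
proof safe
  fix \<phi> assume \<phi>: "moment_bounded G \<delta> \<phi>"
  then have "(\<lambda>x. \<phi> ((s + t) * x)) = (\<lambda>x. \<phi> (s * x) + \<phi> (t * x))"
    unfolding moment_bounded_def by (auto simp: distrib_right linear_add)
  then show "moment_bounded G \<delta> (\<lambda>x. \<phi> ((s + t) * x))"
    using assms \<phi> by (simp add: bounded_multipliers_def moment_bounded_add)
qed

lemma bounded_multipliers_mult:
  assumes "s \<in> bounded_multipliers G \<delta>" "t \<in> bounded_multipliers G \<delta>"
  shows "s * t \<in> bounded_multipliers G \<delta>"
  unfolding bounded_multipliers_def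
proof safe
  fix \<phi> assume "moment_bounded G \<delta> \<phi>"
  then have "moment_bounded G \<delta> (\<lambda>x. \<phi> (s * (t * x)))"
    using assms unfolding bounded_multipliers_def by blast
  then show "moment_bounded G \<delta> (\<lambda>x. \<phi> (s * t * x))"
    by (simp add: mult.assoc)
qed

lemma bounded_multipliers_of_real:
  assumes "r \<ge> 0"
  shows "of_real r \<in> bounded_multipliers G \<delta>"
  unfolding bounded_multipliers_def
proof safe
  fix \<phi> assume \<phi>: "moment_bounded G \<delta> \<phi>"
  then have "(\<lambda>x. \<phi> (of_real r * x)) = (\<lambda>x. r * \<phi> x)"
    unfolding moment_bounded_def by (auto simp: linear_of_real_mult)
  then show "moment_bounded G \<delta> (\<lambda>x. \<phi> (of_real r * x))"
    using moment_bounded_scale[OF \<phi> assms] by simp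
qed

text \<open>Positivity of \<open>x \<mapsto> \<phi> (b\<^sup>2 * x)\<close> on squares is clear. For the growth, the inequality
\<open>0 \<le> \<phi> ((d b\<^sup>2 - a ^ (2 * n))\<^sup>2)\<close> with \<open>d = \<delta> a ^ (2 * n)\<close> bounds the mixed term, which
carries the factor \<open>2 d\<close>, by the sum of \<open>d\<^sup>2 \<phi> (b ^ 4)\<close> and the moment of order \<open>4 * n\<close>; both summands are
of order \<open>d\<^sup>2\<close>.\<close>

lemma bounded_multipliers_square:
  assumes \<delta>: "\<And>a. a \<in> G \<Longrightarrow> \<delta> a > 0"
  shows "b\<^sup>2 \<in> bounded_multipliers G \<delta>"
  unfolding bounded_multipliers_def
proof safe
  fix \<phi> assume \<phi>: "moment_bounded G \<delta> \<phi>"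
  then have lin: "linear \<phi>" and psd: "\<And>x. \<phi> (x\<^sup>2) \<ge> 0"
    unfolding moment_bounded_def psd_functional_def by auto
  have "psd_functional (\<lambda>x. \<phi> (b\<^sup>2 * x))"
    unfolding psd_functional_def using psd[of "b * _"] by (simp add: power_mult_distrib)
  moreover have "\<exists>\<gamma>. \<forall>n. \<phi> (b\<^sup>2 * a ^ (2 * n)) \<le> \<gamma> * \<delta> a ^ (2 * n)" if a: "a \<in> G" for a
  proof -
    obtain \<gamma> where \<gamma>: "\<And>n. \<phi> (a ^ (2 * n)) \<le> \<gamma> * \<delta> a ^ (2 * n)"
      using \<phi> a by (rule moment_boundedE) blast
    have "\<phi> (b\<^sup>2 * a ^ (2 * n)) \<le> (\<phi> (b ^ 4) + \<gamma>) / 2 * \<delta> a ^ (2 * n)" for n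
    proof -
      define d where "d = \<delta> a ^ (2 * n)"
      have d: "d > 0"
        unfolding d_def using \<delta>[OF a] by simp
      have "(of_real d * b\<^sup>2 - a ^ (2 * n))\<^sup>2 =
          of_real (d\<^sup>2) * b ^ 4 - of_real (2 * d) * (b\<^sup>2 * a ^ (2 * n)) + a ^ (2 * (2 * n))"
        by (simp add: power2_diff power_mult_distrib mult_ac flip: power_mult)
      then have "0 \<le> d\<^sup>2 * \<phi> (b ^ 4) - 2 * d * \<phi> (b\<^sup>2 * a ^ (2 * n)) + \<phi> (a ^ (2 * (2 * n)))"
        using psd[of "of_real d * b\<^sup>2 - a ^ (2 * n)"]
        by (simp only: linear_add[OF lin] linear_diff[OF lin] linear_of_real_mult[OF lin])
      moreover have "\<phi> (a ^ (2 * (2 * n))) \<le> \<gamma> * d\<^sup>2"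
        using \<gamma>[of "2 * n"] unfolding d_def by (simp flip: power_mult add: mult.commute)
      ultimately have "d * (2 * \<phi> (b\<^sup>2 * a ^ (2 * n))) \<le> d * ((\<phi> (b ^ 4) + \<gamma>) * d)"
        by (simp add: algebra_simps power2_eq_square)
      then show ?thesis
        using d unfolding d_def[symmetric] by simp
    qed
    then show ?thesis
      by blast
  qed
  ultimately show "moment_bounded G \<delta> (\<lambda>x. \<phi> (b\<^sup>2 * x))"
    using lin linear_compose_mult unfolding moment_bounded_def by blast
qed

text \<open>The increments of a convex sequence increase, so a positive first increment would make the sequence
grow at least linearly.\<close>

lemma convex_bounded_sequence_first_step:
  fixes u :: "nat \<Rightarrow> real"
  assumes convex: "\<And>n. 2 * u (Suc n) \<le> u n + u (Suc (Suc n))" and bound: "\<And>n. u n \<le> B"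
  shows "u 1 \<le> u 0"
proof (rule ccontr)
  assume "\<not> u 1 \<le> u 0"
  then have d: "u 1 - u 0 > 0" by simp
  have step: "u (Suc n) - u n \<ge> u 1 - u 0" for n
  proof (induction n)
    case (Suc n)
    then show ?case
      using convex[of n] by linarith
  qed simp
  have "u n \<ge> u 0 + n * (u 1 - u 0)" for n
  proof (induction n)
    case (Suc n)
    then show ?case
      using step[of n] by (simp add: algebra_simps)
  qed simp
  moreover obtain n :: nat where "(B - u 0) / (u 1 - u 0) < n"
    using reals_Archimedean2 by blast
  then have "B < u 0 + n * (u 1 - u 0)"
    using d by (simp add: field_simps)
  ultimately show False
    using bound[of n] by (meson less_le_trans not_less)
qed

text \<open>The normalised even moments \<open>\<phi> (g ^ (2 * n)) / \<delta> g ^ (2 * n)\<close> form a convex sequence, because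
its second differences are the values of \<open>\<phi>\<close> at the squares of \<open>g ^ n * ((\<delta> g)\<^sup>2 - g\<^sup>2)\<close> up to a
positive factor. By the growth condition the sequence is bounded, hence its first step is not
upwards.\<close>

lemma moment_bounded_square_le:
  assumes \<phi>: "moment_bounded G \<delta> \<phi>" and g: "g \<in> G" and \<delta>: "\<delta> g > 0"
  shows "\<phi> (g\<^sup>2) \<le> (\<delta> g)\<^sup>2 * \<phi> 1"
proof -
  have lin: "linear \<phi>" and psd: "\<And>x. \<phi> (x\<^sup>2) \<ge> 0"
    using \<phi> unfolding moment_bounded_def psd_functional_def by auto
  obtain \<gamma> where \<gamma>: "\<And>n. \<phi> (g ^ (2 * n)) \<le> \<gamma> * \<delta> g ^ (2 * n)"
    using \<phi> g by (rule moment_boundedE) blast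
  define u where "u n = \<phi> (g ^ (2 * n)) / \<delta> g ^ (2 * n)" for n
  have "u 1 \<le> u 0"
  proof (rule convex_bounded_sequence_first_step)
    show "u n \<le> \<gamma>" for n
      unfolding u_def using \<gamma>[of n] \<delta> by (simp add: divide_le_eq)
    show "2 * u (Suc n) \<le> u n + u (Suc (Suc n))" for n
    proof -
      define d where "d = \<delta> g"
      have "(g ^ n * (of_real (d\<^sup>2) - g\<^sup>2))\<^sup>2 =
          of_real (d ^ 4) * g ^ (2 * n) - of_real (2 * d\<^sup>2) * g ^ (2 * Suc n) + g ^ (2 * Suc (Suc n))"
      proof -
        have "(s * (of_real (d\<^sup>2) - y))\<^sup>2 =
            of_real (d ^ 4) * s\<^sup>2 - of_real (2 * d\<^sup>2) * (s\<^sup>2 * y) + s\<^sup>2 * y\<^sup>2" for s y :: 'a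
          by (simp add: power2_eq_square power4_eq_xxxx algebra_simps)
        moreover have "g ^ (2 * n) = (g ^ n)\<^sup>2" "g ^ (2 * Suc n) = (g ^ n)\<^sup>2 * g\<^sup>2"
          "g ^ (2 * Suc (Suc n)) = (g ^ n)\<^sup>2 * (g\<^sup>2)\<^sup>2"
          by (simp_all only: power_mult[symmetric] power_add[symmetric])
            (rule arg_cong[of _ _ "power g"], simp)+
        ultimately show ?thesis
          by (simp only:)
      qed
      then have "0 \<le> d ^ 4 * \<phi> (g ^ (2 * n)) - 2 * d\<^sup>2 * \<phi> (g ^ (2 * Suc n)) + \<phi> (g ^ (2 * Suc (Suc n)))"
        using psd[of "g ^ n * (of_real (d\<^sup>2) - g\<^sup>2)"]
        by (simp only: linear_add[OF lin] linear_diff[OF lin] linear_of_real_mult[OF lin])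
      also have "\<dots> = d ^ (2 * n + 4) * (u n - 2 * u (Suc n) + u (Suc (Suc n)))"
      proof -
        have "\<phi> (g ^ (2 * n)) = d ^ (2 * n) * u n" for n
          using \<delta> unfolding u_def d_def by simp
        moreover have "d ^ 4 * (d ^ (2 * n) * p) - 2 * d\<^sup>2 * (d ^ (2 * Suc n) * q) + d ^ (2 * Suc (Suc n)) * r
            = d ^ (2 * n + 4) * (p - 2 * q + r)" for p q r
          by (simp add: algebra_simps power_add power2_eq_square power4_eq_xxxx)
        ultimately show ?thesis
          by (simp only:)
      qed
      finally have "0 \<le> u n - 2 * u (Suc n) + u (Suc (Suc n))"
        using \<delta> zero_less_power[of d "2 * n + 4"] unfolding d_def
        by (metis not_less mult_pos_neg)
      then show ?thesis
        by simp
    qed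
  qed
  then show ?thesis
    unfolding u_def using \<delta> by (simp add: field_simps power2_eq_square)
qed

text \<open>The preceding inequality, applied to the functionals \<open>y \<mapsto> \<phi> (x\<^sup>2 * y)\<close>, which belong to the same
class, says that \<open>x \<mapsto> \<phi> (((\<delta> g)\<^sup>2 - g\<^sup>2) * x)\<close> is nonnegative on squares. Its growth is no worse than
that of \<open>(\<delta> g)\<^sup>2 * \<phi>\<close>.\<close>

lemma bounded_multipliers_generator_square:
  assumes g: "g \<in> G" and \<delta>: "\<And>a. a \<in> G \<Longrightarrow> \<delta> a > 0"
  shows "of_real ((\<delta> g)\<^sup>2) - g\<^sup>2 \<in> bounded_multipliers G \<delta>"
  unfolding bounded_multipliers_def
proof safe
  fix \<phi> assume \<phi>: "moment_bounded G \<delta> \<phi>"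
  then have lin: "linear \<phi>" and psd: "\<And>x. \<phi> (x\<^sup>2) \<ge> 0"
    unfolding moment_bounded_def psd_functional_def by auto
  have expand: "\<phi> ((of_real ((\<delta> g)\<^sup>2) - g\<^sup>2) * x) = (\<delta> g)\<^sup>2 * \<phi> x - \<phi> (g\<^sup>2 * x)" for x
    by (simp only: left_diff_distrib linear_diff[OF lin] linear_of_real_mult[OF lin])
  have "\<phi> (g\<^sup>2 * x\<^sup>2) \<le> (\<delta> g)\<^sup>2 * \<phi> (x\<^sup>2)" for x
  proof -
    have "moment_bounded G \<delta> (\<lambda>y. \<phi> (x\<^sup>2 * y))"
      using bounded_multipliers_square[of G \<delta> x] \<delta> \<phi> unfolding bounded_multipliers_def by blast
    from moment_bounded_square_le[OF this g \<delta>[OF g]] show ?thesis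
      by (simp add: mult.commute)
  qed
  then have "psd_functional (\<lambda>x. \<phi> ((of_real ((\<delta> g)\<^sup>2) - g\<^sup>2) * x))"
    unfolding psd_functional_def expand by simp
  moreover have "\<exists>\<gamma>. \<forall>n. \<phi> ((of_real ((\<delta> g)\<^sup>2) - g\<^sup>2) * a ^ (2 * n)) \<le> \<gamma> * \<delta> a ^ (2 * n)"
    if a: "a \<in> G" for a
  proof -
    obtain \<gamma> where \<gamma>: "\<And>n. \<phi> (a ^ (2 * n)) \<le> \<gamma> * \<delta> a ^ (2 * n)"
      using \<phi> a by (rule moment_boundedE) blast
    have "\<phi> ((of_real ((\<delta> g)\<^sup>2) - g\<^sup>2) * a ^ (2 * n)) \<le> ((\<delta> g)\<^sup>2 * \<gamma>) * \<delta> a ^ (2 * n)" for n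
    proof -
      have "\<phi> (g\<^sup>2 * a ^ (2 * n)) \<ge> 0"
        using psd[of "g * a ^ n"] by (simp add: power_mult_distrib mult.commute flip: power_mult)
      moreover have "(\<delta> g)\<^sup>2 * \<phi> (a ^ (2 * n)) \<le> (\<delta> g)\<^sup>2 * (\<gamma> * \<delta> a ^ (2 * n))"
        using \<gamma> by (intro mult_left_mono) auto
      ultimately show ?thesis
        unfolding expand by (simp add: mult.assoc)
    qed
    then show ?thesis by blast
  qed
  ultimately show "moment_bounded G \<delta> (\<lambda>x. \<phi> ((of_real ((\<delta> g)\<^sup>2) - g\<^sup>2) * x))"
    using lin linear_compose_mult unfolding moment_bounded_def by blast
qed

text \<open>This is the identity \<open>2 \<delta> (\<delta> \<plusminus> g) = (\<delta>\<^sup>2 - g\<^sup>2) + (\<delta> \<plusminus> g)\<^sup>2\<close> with \<open>\<delta>\<close> short for \<open>\<delta> g\<close>.\<close>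

lemma bounded_multipliers_generator:
  assumes g: "g \<in> G" and \<delta>: "\<And>a. a \<in> G \<Longrightarrow> \<delta> a > 0"
  shows "of_real (\<delta> g) - g \<in> bounded_multipliers G \<delta>" "of_real (\<delta> g) + g \<in> bounded_multipliers G \<delta>"
proof -
  let ?T = "bounded_multipliers G \<delta>"
  \<comment> \<open>Both signs are treated at once, with \<open>s\<close> standing for 1 or \<open>- 1\<close>.\<close>
  have *: "of_real (\<delta> g) + s * g \<in> ?T" if s: "s * s = 1" for s
  proof -
    have "of_real (1 / (2 * \<delta> g)) * ((of_real ((\<delta> g)\<^sup>2) - g\<^sup>2) + (of_real (\<delta> g) + s * g)\<^sup>2) \<in> ?T"
      using \<delta> g by (intro bounded_multipliers_mult bounded_multipliers_add bounded_multipliers_of_real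
          bounded_multipliers_square bounded_multipliers_generator_square) (auto simp: less_imp_le)
    also have "(of_real ((\<delta> g)\<^sup>2) - g\<^sup>2) + (of_real (\<delta> g) + s * g)\<^sup>2 =
        of_real (2 * \<delta> g) * (of_real (\<delta> g) + s * g) + (s * s - 1) * g\<^sup>2"
      by (simp add: algebra_simps power2_eq_square)
    also have "of_real (1 / (2 * \<delta> g)) * (of_real (2 * \<delta> g) * (of_real (\<delta> g) + s * g) + (s * s - 1) * g\<^sup>2)
        = of_real (1 / (2 * \<delta> g) * (2 * \<delta> g)) * (of_real (\<delta> g) + s * g)"
      unfolding s of_real_mult by (simp add: mult.assoc)
    also have "1 / (2 * \<delta> g) * (2 * \<delta> g) = 1"
      using \<delta>[OF g] by simp
    finally show ?thesis
      by simp
  qed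
  show "of_real (\<delta> g) - g \<in> ?T" "of_real (\<delta> g) + g \<in> ?T"
    using *[of "- 1"] *[of 1] by simp_all
qed

text \<open>The elements bounded on both sides by constants, modulo the semiring, form a subalgebra. It contains
the generators, so it is everything.\<close>

lemma archimedean_bounded_multipliers:
  assumes gen: "generates_algebra G" and \<delta>: "\<And>a. a \<in> G \<Longrightarrow> \<delta> a > 0"
  shows "archimedean_semiring (bounded_multipliers G \<delta>)"
proof
  let ?T = "bounded_multipliers G \<delta>"
  note closed = bounded_multipliers_add bounded_multipliers_mult bounded_multipliers_of_real
  let ?B = "{x. \<exists>r\<ge>0. of_real r - x \<in> ?T \<and> of_real r + x \<in> ?T}"
  have B_mult: "x * y \<in> ?B" if xy: "x \<in> ?B" "y \<in> ?B" for x y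
  proof -
    obtain p q where p: "p \<ge> 0" "of_real p - x \<in> ?T" "of_real p + x \<in> ?T"
      and q: "q \<ge> 0" "of_real q - y \<in> ?T" "of_real q + y \<in> ?T"
      using xy by blast
    have "of_real (1/2) * ((of_real p - x) * (of_real q + y) + (of_real p + x) * (of_real q - y)) \<in> ?T"
      "of_real (1/2) * ((of_real p - x) * (of_real q - y) + (of_real p + x) * (of_real q + y)) \<in> ?T"
      using closed(2)[OF closed(3) closed(1)[OF closed(2)[OF p(2) q(3)] closed(2)[OF p(3) q(2)]], of "1/2"]
        closed(2)[OF closed(3) closed(1)[OF closed(2)[OF p(2) q(2)] closed(2)[OF p(3) q(3)]], of "1/2"]
      by simp_all
    moreover have
      "(of_real p - x) * (of_real q + y) + (of_real p + x) * (of_real q - y) = of_real 2 * (of_real (p * q) - x * y)"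
      "(of_real p - x) * (of_real q - y) + (of_real p + x) * (of_real q + y) = of_real 2 * (of_real (p * q) + x * y)"
      by (simp_all add: algebra_simps)
    moreover have "of_real (1/2) * (of_real 2 * z) = z" for z :: 'a
      unfolding mult.assoc[symmetric] of_real_mult[symmetric] by simp
    ultimately have "of_real (p * q) - x * y \<in> ?T" "of_real (p * q) + x * y \<in> ?T"
      by metis+
    then show ?thesis
      using p(1) q(1) by (auto intro!: exI[of _ "p * q"])
  qed
  have B_add: "x + y \<in> ?B" if xy: "x \<in> ?B" "y \<in> ?B" for x y
  proof -
    obtain p q where p: "p \<ge> 0" "of_real p - x \<in> ?T" "of_real p + x \<in> ?T"
      and q: "q \<ge> 0" "of_real q - y \<in> ?T" "of_real q + y \<in> ?T"
      using xy by blast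
    have "of_real (p + q) - (x + y) \<in> ?T" "of_real (p + q) + (x + y) \<in> ?T"
      using bounded_multipliers_add[OF p(2) q(2)] bounded_multipliers_add[OF p(3) q(3)]
      by (simp_all add: algebra_simps)
    then show ?thesis
      using p(1) q(1) by (auto intro!: exI[of _ "p + q"])
  qed
  have B_of_real: "of_real c \<in> ?B" for c
  proof -
    have "0 \<le> \<bar>c\<bar> - c" "0 \<le> \<bar>c\<bar> + c"
      by linarith+
    then have "of_real (\<bar>c\<bar> - c) \<in> ?T" "of_real (\<bar>c\<bar> + c) \<in> ?T"
      using bounded_multipliers_of_real by blast+
    then show ?thesis
      by (intro CollectI exI[of _ "\<bar>c\<bar>"]) simp
  qed
  define B where "B = ?B"
  note B = B_mult[folded B_def] B_add[folded B_def] B_of_real[folded B_def]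
  have "0 \<in> B" "1 \<in> B"
    using B(3)[of 0] B(3)[of 1] by simp_all
  moreover have "c *\<^sub>R x \<in> B" if "x \<in> B" for c x
    unfolding scaleR_conv_of_real using B(1)[OF B(3) that] .
  ultimately have "real_subalgebra B"
    unfolding real_subalgebra_def subspace_def using B(1,2) by blast
  moreover have "G \<subseteq> B"
  proof
    fix g assume "g \<in> G"
    then show "g \<in> B"
      unfolding B_def using bounded_multipliers_generator[where \<delta> = \<delta>, OF \<open>g \<in> G\<close> \<delta>] \<delta>[OF \<open>g \<in> G\<close>]
      by (intro CollectI exI[of _ "\<delta> g"]) simp
  qed
  ultimately have "B = UNIV"
    using gen hull_minimal[of G B real_subalgebra] unfolding generates_algebra_def by auto
  then have "x \<in> B" for x
    by simp
  then show "\<exists>r. of_real r - x \<in> ?T" for x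
    unfolding B_def by blast
qed (fact bounded_multipliers_add bounded_multipliers_mult bounded_multipliers_of_real)+

text \<open>A functional of the class is nonnegative on its multipliers. If \<open>a\<close> is nonnegative at all the
characters in question, then every \<open>a + e\<close> with \<open>e > 0\<close> is a multiplier: a character separating it
from the semiring would be nonnegative at \<open>\<delta> g - g\<close> and \<open>\<delta> g + g\<close>, hence among these characters, and
negative at \<open>a\<close>.\<close>

theorem moment_bounded_nonneg:
  assumes \<phi>: "moment_bounded G \<delta> \<phi>" and gen: "generates_algebra G"
    and \<delta>: "\<And>a. a \<in> G \<Longrightarrow> \<delta> a > 0"
    and pos_on_K: "\<And>\<alpha>. \<alpha> \<in> character_space \<Longrightarrow> (\<And>g. g \<in> G \<Longrightarrow> \<bar>\<alpha> g\<bar> \<le> \<delta> g) \<Longrightarrow> \<alpha> a \<ge> 0"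
  shows "\<phi> a \<ge> 0"
proof -
  interpret archimedean_semiring "bounded_multipliers G \<delta>"
    by (rule archimedean_bounded_multipliers[OF gen \<delta>])
  have lin: "linear \<phi>"
    using \<phi> unfolding moment_bounded_def by blast
  have shifted: "a + of_real e \<in> bounded_multipliers G \<delta>" if "e > 0" for e
  proof (rule ccontr)
    assume "a + of_real e \<notin> bounded_multipliers G \<delta>"
    then obtain \<alpha> where \<alpha>: "\<alpha> \<in> character_space" "\<And>t. t \<in> bounded_multipliers G \<delta> \<Longrightarrow> \<alpha> t \<ge> 0"
      "\<alpha> (a + of_real e) \<le> 0"
      by (rule separating_character) blast
    note ch = characterD[OF \<alpha>(1)]
    have in_K: "\<bar>\<alpha> g\<bar> \<le> \<delta> g" if "g \<in> G" for g
      using \<alpha>(2)[OF bounded_multipliers_generator(1)[OF that \<delta>]]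
        \<alpha>(2)[OF bounded_multipliers_generator(2)[OF that \<delta>]]
      by (simp add: linear_add[OF ch(1)] linear_diff[OF ch(1)] ch(4))
    have "\<alpha> a \<ge> 0"
      by (rule pos_on_K[OF \<alpha>(1) in_K])
    then show False
      using \<alpha>(3) \<open>e > 0\<close> by (simp add: linear_add[OF ch(1)] ch(4))
  qed
  have one: "\<phi> 1 \<ge> 0"
    using \<phi> unfolding moment_bounded_def psd_functional_def by (metis one_power2)
  show ?thesis
  proof (rule field_le_epsilon)
    fix e :: real assume "e > 0"
    then have e': "e / (\<phi> 1 + 1) > 0" "e / (\<phi> 1 + 1) * \<phi> 1 \<le> e"
      using one by (simp_all add: field_simps)
    from moment_bounded_nonneg_multiplier[OF \<phi> shifted[OF e'(1)]]
    have "0 \<le> \<phi> a + e / (\<phi> 1 + 1) * \<phi> 1"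
      using linear_of_real_mult[OF lin, of _ 1] by (simp only: linear_add[OF lin] mult_1_right)
    then show "0 \<le> \<phi> a + e"
      using e'(2) by linarith
  qed
qed

section \<open>Riesz representation on a compact set\<close>

lemma compact_Urysohn:
  fixes K :: "'b::t2_space set"
  assumes K: "compact K" and C: "compact C" "C \<subseteq> K" and D: "compact D" "D \<subseteq> K"
    and disj: "C \<inter> D = {}"
  obtains u :: "'b \<Rightarrow> real" where "continuous_on K u" "\<And>x. x \<in> K \<Longrightarrow> 0 \<le> u x"
    "\<And>x. x \<in> K \<Longrightarrow> u x \<le> 1" "\<And>x. x \<in> C \<Longrightarrow> u x = 0" "\<And>x. x \<in> D \<Longrightarrow> u x = 1"
proof -
  have "Hausdorff_space (euclidean :: 'b topology)"
    unfolding Hausdorff_space_def disjnt_def by (simp, metis hausdorff)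
  then have "normal_space (top_of_set K)"
    using K by (intro compact_Hausdorff_or_regular_imp_normal_space)
      (auto simp: compact_space_subtopology Hausdorff_space_subtopology)
  moreover have "closedin (top_of_set K) C" "closedin (top_of_set K) D"
    using C D by (auto intro: closed_subset compact_imp_closed)
  moreover have "disjnt C D"
    using disj by (simp add: disjnt_def)
  ultimately obtain u where u: "continuous_map (top_of_set K) (top_of_set {0..1 :: real}) u"
    "u ` C \<subseteq> {0}" "u ` D \<subseteq> {1}"
    by (rule Urysohn_lemma[where a = 0 and b = 1]) auto
  from u(1) have "continuous_on K u" "u \<in> K \<rightarrow> {0..1}"
    by (auto simp: continuous_map_in_subtopology)
  then show thesis
    using that[of u] u(2,3) by fastforce
qed

lemma ennreal_less_add_pos:
  fixes x :: ennreal
  assumes "x < top" "0 < e"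
  shows "x < x + ennreal e"
  using assms by (cases x) (auto simp: ennreal_less_iff simp flip: ennreal_plus)

text \<open>The functional acts on all functions of the type, but its values matter only for functions
continuous on \<open>K\<close>; positivity makes them depend only on the restriction to \<open>K\<close>.\<close>

locale positive_functional =
  fixes K :: "'b::t2_space set" and I :: "('b \<Rightarrow> real) \<Rightarrow> real"
  assumes compact_K: "compact K"
    and add: "continuous_on K f \<Longrightarrow> continuous_on K g \<Longrightarrow> I (\<lambda>x. f x + g x) = I f + I g"
    and scale: "continuous_on K f \<Longrightarrow> I (\<lambda>x. c * f x) = c * I f"
    and nonneg: "continuous_on K f \<Longrightarrow> (\<And>x. x \<in> K \<Longrightarrow> 0 \<le> f x) \<Longrightarrow> 0 \<le> I f"
begin

lemma diff:
  assumes "continuous_on K f" "continuous_on K g"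
  shows "I (\<lambda>x. f x - g x) = I f - I g"
  using add[of f "\<lambda>x. (- 1) * g x"] scale[of g "- 1"] assms by (simp add: continuous_on_minus)

lemma mono:
  assumes "continuous_on K f" "continuous_on K g" "\<And>x. x \<in> K \<Longrightarrow> f x \<le> g x"
  shows "I f \<le> I g"
  using nonneg[of "\<lambda>x. g x - f x"] diff[of g f] assms by (simp add: continuous_on_diff)

lemma cong:
  assumes "continuous_on K f" "continuous_on K g" "\<And>x. x \<in> K \<Longrightarrow> f x = g x"
  shows "I f = I g"
  using assms by (intro antisym mono) auto

lemma const: "I (\<lambda>x. c) = c * I (\<lambda>x. 1)"
  using scale[of "\<lambda>x. 1" c] by simp

lemma I_one_nonneg: "0 \<le> I (\<lambda>x. 1)"
  by (rule nonneg) auto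

lemma sum:
  assumes "\<And>k::nat. continuous_on K (f k)"
  shows "I (\<lambda>x. \<Sum>k<n. f k x) = (\<Sum>k<n. I (f k))"
proof (induction n)
  case 0
  then show ?case
    using const[of 0] by simp
next
  case (Suc n)
  then show ?case
    using assms by (simp add: add continuous_on_sum)
qed

definition majorant :: "('b \<Rightarrow> real) \<Rightarrow> 'b set \<Rightarrow> bool" where
  "majorant f C \<longleftrightarrow> continuous_on K f \<and> (\<forall>x\<in>K. 0 \<le> f x) \<and> (\<forall>x\<in>C. 1 \<le> f x)"

text \<open>The measure is built in three stages. A compact set is measured by the functions majorising its
indicator, an open set from inside by compact sets, and an arbitrary set from outside by open sets.
Everything outside \<open>K\<close> is negligible, which allows open sets of the whole space to be used in place of
relatively open subsets of \<open>K\<close>.\<close>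

definition compact_content :: "'b set \<Rightarrow> ennreal" where
  "compact_content C = (INF f\<in>{f. majorant f C}. ennreal (I f))"

definition inner_content :: "'b set \<Rightarrow> ennreal" where
  "inner_content U = (SUP C\<in>{C. compact C \<and> C \<subseteq> U \<inter> K}. compact_content C)"

definition outer :: "'b set \<Rightarrow> ennreal" where
  "outer E = (INF U\<in>{U. open U \<and> E \<subseteq> U}. inner_content U)"

lemma majorant_nonneg: "majorant f C \<Longrightarrow> 0 \<le> I f"
  unfolding majorant_def by (auto intro: nonneg)

lemma content_le: "majorant f C \<Longrightarrow> compact_content C \<le> ennreal (I f)"
  unfolding compact_content_def by (rule INF_lower) simp

lemma content_mono: "C \<subseteq> D \<Longrightarrow> compact_content C \<le> compact_content D"
  unfolding compact_content_def majorant_def by (rule INF_superset_mono) auto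

lemma content_less_top: "compact_content C < top"
proof -
  have "majorant (\<lambda>x. 1) C"
    unfolding majorant_def by auto
  from content_le[OF this] show ?thesis
    by (rule le_less_trans) simp
qed

lemma content_empty: "compact_content {} = 0"
proof -
  have "majorant (\<lambda>x. 0) {}"
    unfolding majorant_def by auto
  from content_le[OF this] show ?thesis
    using const[of 0] by simp
qed

lemma content_approx:
  assumes "e > 0"
  obtains f where "majorant f C" "ennreal (I f) \<le> compact_content C + ennreal e"
proof -
  have "compact_content C < compact_content C + ennreal e"
    by (rule ennreal_less_add_pos[OF content_less_top assms])
  then obtain f where "majorant f C" "ennreal (I f) < compact_content C + ennreal e"
    unfolding compact_content_def INF_less_iff by auto
  then show thesis
    using that by (simp add: less_imp_le)
qed

lemma content_Un:
  assumes "C \<subseteq> K" "D \<subseteq> K"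
  shows "compact_content (C \<union> D) \<le> compact_content C + compact_content D"
proof (rule ennreal_le_epsilon)
  fix e :: real assume "0 < e"
  then have "0 < e / 2" by simp
  obtain f where f: "majorant f C" "ennreal (I f) \<le> compact_content C + ennreal (e / 2)"
    using content_approx[OF \<open>0 < e / 2\<close>] .
  obtain g where g: "majorant g D" "ennreal (I g) \<le> compact_content D + ennreal (e / 2)"
    using content_approx[OF \<open>0 < e / 2\<close>] .
  have "majorant (\<lambda>x. f x + g x) (C \<union> D)"
    using f(1) g(1) assms unfolding majorant_def
    by (auto simp: subset_iff intro!: continuous_on_add intro: add_increasing add_increasing2)
  then have "compact_content (C \<union> D) \<le> ennreal (I (\<lambda>x. f x + g x))"
    by (rule content_le)
  also have "\<dots> = ennreal (I f) + ennreal (I g)"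
    using f(1) g(1) majorant_nonneg[OF f(1)] majorant_nonneg[OF g(1)] unfolding majorant_def
    by (subst add) (auto simp: ennreal_plus)
  also have "\<dots> \<le> (compact_content C + ennreal (e / 2)) + (compact_content D + ennreal (e / 2))"
    by (rule add_mono[OF f(2) g(2)])
  also have "\<dots> = compact_content C + compact_content D + (ennreal (e / 2) + ennreal (e / 2))"
    by (simp add: ac_simps)
  also have "ennreal (e / 2) + ennreal (e / 2) = ennreal e"
    using \<open>0 < e\<close> by (simp flip: ennreal_plus)
  finally show "compact_content (C \<union> D) \<le> compact_content C + compact_content D + ennreal e" .
qed

text \<open>An Urysohn function \<open>u\<close> for the two sets splits a majorant \<open>f\<close> of the union into the majorants
\<open>f * (1 - u)\<close> of \<open>C\<close> and \<open>f * u\<close> of \<open>D\<close>.\<close>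

lemma content_disjoint_Un:
  assumes C: "compact C" "C \<subseteq> K" and D: "compact D" "D \<subseteq> K" and disj: "C \<inter> D = {}"
  shows "compact_content C + compact_content D \<le> compact_content (C \<union> D)"
  unfolding compact_content_def[of "C \<union> D"]
proof (rule INF_greatest, unfold mem_Collect_eq)
  fix f assume f: "majorant f (C \<union> D)"
  obtain u :: "'b \<Rightarrow> real" where u: "continuous_on K u" "\<And>x. x \<in> K \<Longrightarrow> 0 \<le> u x"
    "\<And>x. x \<in> K \<Longrightarrow> u x \<le> 1" "\<And>x. x \<in> C \<Longrightarrow> u x = 0" "\<And>x. x \<in> D \<Longrightarrow> u x = 1"
    by (rule compact_Urysohn[OF compact_K C D disj]) blast
  have 1: "majorant (\<lambda>x. f x * (1 - u x)) C" and 2: "majorant (\<lambda>x. f x * u x) D"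
    using f u unfolding majorant_def by (auto intro!: continuous_intros)
  have "compact_content C + compact_content D \<le> ennreal (I (\<lambda>x. f x * (1 - u x))) + ennreal (I (\<lambda>x. f x * u x))"
    by (intro add_mono content_le 1 2)
  also have "\<dots> = ennreal (I (\<lambda>x. f x * (1 - u x)) + I (\<lambda>x. f x * u x))"
    using majorant_nonneg[OF 1] majorant_nonneg[OF 2] by simp
  also have "I (\<lambda>x. f x * (1 - u x)) + I (\<lambda>x. f x * u x) = I (\<lambda>x. f x * (1 - u x) + f x * u x)"
    using 1 2 unfolding majorant_def by (intro add[symmetric]) auto
  also have "(\<lambda>x. f x * (1 - u x) + f x * u x) = f"
    by (auto simp: algebra_simps)
  finally show "compact_content C + compact_content D \<le> ennreal (I f)" .
qed

lemma inner_content_upper: "compact C \<Longrightarrow> C \<subseteq> U \<Longrightarrow> C \<subseteq> K \<Longrightarrow> compact_content C \<le> inner_content U"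
  unfolding inner_content_def by (rule SUP_upper) auto

lemma inner_content_mono: "U \<subseteq> V \<Longrightarrow> inner_content U \<le> inner_content V"
  unfolding inner_content_def by (rule SUP_subset_mono) auto

lemma inner_content_empty: "inner_content {} = 0"
proof -
  have "{C :: 'b set. compact C \<and> C \<subseteq> {} \<inter> K} = {{}}"
    by auto
  then show ?thesis
    unfolding inner_content_def by (simp add: content_empty)
qed

lemma inner_content_less_top: "inner_content U < top"
proof -
  have "inner_content U \<le> compact_content K"
    unfolding inner_content_def by (rule SUP_least) (auto intro: content_mono)
  then show ?thesis
    using content_less_top by (rule le_less_trans)
qed

text \<open>A compact subset of the union is cut into a compact part in \<open>U\<close> and one in \<open>V\<close> along the level
\<open>1/2\<close> of an Urysohn function that separates its parts outside \<open>V\<close> and outside \<open>U\<close>.\<close>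

lemma inner_content_Un:
  assumes "open U" "open V"
  shows "inner_content (U \<union> V) \<le> inner_content U + inner_content V"
  unfolding inner_content_def[of "U \<union> V"]
proof (rule SUP_least, unfold mem_Collect_eq, elim conjE)
  fix C assume C: "compact C" "C \<subseteq> (U \<union> V) \<inter> K"
  obtain u :: "'b \<Rightarrow> real" where u: "continuous_on K u" 
    "\<And>x. x \<in> C - V \<Longrightarrow> u x = 0" "\<And>x. x \<in> C - U \<Longrightarrow> u x = 1"
    by (rule compact_Urysohn[OF compact_K compact_diff[OF C(1) assms(2)] _ compact_diff[OF C(1) assms(1)]])
      (use C in auto)
  have cu: "continuous_on C u"
    by (rule continuous_on_subset[OF u(1)]) (use C in auto)
  have "closed C"
    using C(1) by (rule compact_imp_closed)
  define A where "A = {x \<in> C. u x \<le> 1/2}"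
  define B where "B = {x \<in> C. 1/2 \<le> u x}"
  have "closed A" "closed B"
    unfolding A_def B_def using cu \<open>closed C\<close>
    by (auto intro!: continuous_on_closed_Collect_le continuous_intros)
  then have "compact (C \<inter> A)" "compact (C \<inter> B)"
    using C(1) by (auto intro: compact_Int_closed)
  then have AB: "compact A" "compact B"
    by (simp_all add: A_def B_def Int_def conj_commute cong: conj_cong)
  have sub: "A \<subseteq> U" "A \<subseteq> K" "B \<subseteq> V" "B \<subseteq> K" and C_eq: "C = A \<union> B"
    using C(2) u(2,3) unfolding A_def B_def by force+
  have "compact_content C \<le> compact_content A + compact_content B"
    unfolding C_eq using sub by (intro content_Un)
  also have "\<dots> \<le> inner_content U + inner_content V"
    using AB sub by (intro add_mono inner_content_upper)
  finally show "compact_content C \<le> inner_content U + inner_content V" .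
qed

lemma inner_content_UN_lessThan:
  assumes "\<And>i::nat. open (U i)"
  shows "inner_content (\<Union>i<n. U i) \<le> (\<Sum>i<n. inner_content (U i))"
proof (induction n)
  case 0
  then show ?case
    by (simp add: inner_content_empty)
next
  case (Suc n)
  have "inner_content (\<Union>i<Suc n. U i) = inner_content ((\<Union>i<n. U i) \<union> U n)"
    by (simp add: lessThan_Suc Un_commute)
  also have "\<dots> \<le> inner_content (\<Union>i<n. U i) + inner_content (U n)"
    using assms by (intro inner_content_Un) auto
  also have "\<dots> \<le> (\<Sum>i<Suc n. inner_content (U i))"
    using Suc by (simp add: add_right_mono)
  finally show ?case .
qed

lemma inner_content_UN:
  assumes "\<And>i::nat. open (U i)"
  shows "inner_content (\<Union>i. U i) \<le> (\<Sum>i. inner_content (U i))"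
  unfolding inner_content_def[of "\<Union>i. U i"]
proof (rule SUP_least, unfold mem_Collect_eq, elim conjE)
  fix C assume C: "compact C" "C \<subseteq> (\<Union>i. U i) \<inter> K"
  obtain S where S: "finite S" "C \<subseteq> (\<Union>i\<in>S. U i)"
    using compactE_image[OF C(1), of UNIV U] assms C(2) by auto
  obtain n where "S \<subseteq> {..<n}"
    using finite_nat_bounded[OF S(1)] by blast
  then have "C \<subseteq> (\<Union>i<n. U i)"
    using S(2) by blast
  then have "compact_content C \<le> inner_content (\<Union>i<n. U i)"
    using C by (intro inner_content_upper) auto
  also have "\<dots> \<le> (\<Sum>i<n. inner_content (U i))"
    by (rule inner_content_UN_lessThan[OF assms])
  also have "\<dots> \<le> (\<Sum>i. inner_content (U i))"
    by (rule sum_le_suminf) auto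
  finally show "compact_content C \<le> (\<Sum>i. inner_content (U i))" .
qed

lemma outer_le: "open U \<Longrightarrow> E \<subseteq> U \<Longrightarrow> outer E \<le> inner_content U"
  unfolding outer_def by (rule INF_lower) simp

lemma outer_open: "open U \<Longrightarrow> outer U = inner_content U"
  by (intro antisym outer_le) (auto simp: outer_def intro!: INF_greatest inner_content_mono)

lemma outer_mono: "E \<subseteq> F \<Longrightarrow> outer E \<le> outer F"
  unfolding outer_def by (rule INF_superset_mono) auto

lemma outer_less_top: "outer E < top"
  using outer_le[of UNIV E] inner_content_less_top[of UNIV] by (simp add: le_less_trans)

lemma outer_approx:
  assumes "e > 0"
  obtains U where "open U" "E \<subseteq> U" "inner_content U \<le> outer E + ennreal e"
proof -
  have "outer E < outer E + ennreal e"
    by (rule ennreal_less_add_pos[OF outer_less_top assms])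
  then obtain U where "open U" "E \<subseteq> U" "inner_content U < outer E + ennreal e"
    unfolding outer_def INF_less_iff by auto
  then show thesis
    using that by (simp add: less_imp_le)
qed

text \<open>A majorant \<open>f\<close> of \<open>C\<close> exceeds \<open>1 - d\<close> on a neighbourhood of \<open>C\<close>, and there \<open>f + d\<close> is a majorant
whose value is larger only by \<open>d\<close> times the value at 1.\<close>

lemma outer_compact_le:
  assumes "C \<subseteq> K"
  shows "outer C \<le> compact_content C"
proof (rule ennreal_le_epsilon)
  fix e :: real assume "0 < e"
  then have "0 < e / 2" by simp
  obtain f where f: "majorant f C" "ennreal (I f) \<le> compact_content C + ennreal (e / 2)"
    using content_approx[OF \<open>0 < e / 2\<close>] .
  define d where "d = e / 2 / (I (\<lambda>x. 1) + 1)"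
  have d: "d > 0" "d * I (\<lambda>x. 1) \<le> e / 2"
    using I_one_nonneg \<open>0 < e\<close> unfolding d_def by (simp_all add: field_simps)
  have cf: "continuous_on K f"
    using f(1) unfolding majorant_def by blast
  obtain W where W: "open W" "W \<inter> K = f -` {1 - d<..} \<inter> K"
    using cf[unfolded continuous_on_open_invariant] open_greaterThan by meson
  have "C \<subseteq> W"
    using W(2) f(1) d(1) assms unfolding majorant_def by fastforce
  have "outer C \<le> inner_content W"
    by (rule outer_le[OF W(1) \<open>C \<subseteq> W\<close>])
  also have "\<dots> \<le> ennreal (I f + e / 2)"
    unfolding inner_content_def
  proof (rule SUP_least, unfold mem_Collect_eq, elim conjE)
    fix B assume "compact B" "B \<subseteq> W \<inter> K"
    then have "majorant (\<lambda>x. f x + d) B"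
      using W(2) f(1) d(1) unfolding majorant_def by (force intro!: continuous_intros)
    then have "compact_content B \<le> ennreal (I (\<lambda>x. f x + d))"
      by (rule content_le)
    also have "I (\<lambda>x. f x + d) = I f + d * I (\<lambda>x. 1)"
      using add[OF cf, of "\<lambda>x. d"] const[of d] by simp
    finally show "compact_content B \<le> ennreal (I f + e / 2)"
      using d(2) by (meson add_left_mono ennreal_leI order_trans)
  qed
  also have "\<dots> = ennreal (I f) + ennreal (e / 2)"
    using majorant_nonneg[OF f(1)] \<open>0 < e\<close> by simp
  also have "\<dots> \<le> compact_content C + ennreal (e / 2) + ennreal (e / 2)"
    by (rule add_right_mono[OF f(2)])
  also have "\<dots> = compact_content C + (ennreal (e / 2) + ennreal (e / 2))"
    by (simp add: ac_simps)
  also have "ennreal (e / 2) + ennreal (e / 2) = ennreal e"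
    using \<open>0 < e\<close> by (simp flip: ennreal_plus)
  finally show "outer C \<le> compact_content C + ennreal e" .
qed

lemma outer_measure_space_outer: "outer_measure_space UNIV outer"
  unfolding outer_measure_space_def
proof (intro conjI)
  show "positive UNIV outer"
    unfolding positive_def using outer_open[of "{}"] inner_content_empty by simp
  show "increasing UNIV outer"
    unfolding increasing_def using outer_mono by blast
  show "countably_subadditive UNIV outer"
    unfolding countably_subadditive_def
  proof (intro allI impI)
    fix A :: "nat \<Rightarrow> 'b set"
    show "outer (\<Union>i. A i) \<le> (\<Sum>i. outer (A i))"
    proof (rule ennreal_le_epsilon)
      fix e :: real assume "0 < e"
      have "\<exists>U. open U \<and> A i \<subseteq> U \<and> inner_content U \<le> outer (A i) + ennreal (e * (1/2) ^ Suc i)" for i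
        using outer_approx[of "e * (1/2) ^ Suc i" "A i"] \<open>0 < e\<close>
        by (metis mult_pos_pos zero_less_power half_gt_zero_iff zero_less_one)
      then obtain U where U: "\<And>i. open (U i)" "\<And>i. A i \<subseteq> U i"
        "\<And>i. inner_content (U i) \<le> outer (A i) + ennreal (e * (1/2) ^ Suc i)"
        by metis
      have "outer (\<Union>i. A i) \<le> inner_content (\<Union>i. U i)"
        using U by (intro outer_le) auto
      also have "\<dots> \<le> (\<Sum>i. inner_content (U i))"
        by (rule inner_content_UN[OF U(1)])
      also have "\<dots> \<le> (\<Sum>i. outer (A i) + ennreal (e * (1/2) ^ Suc i))"
        by (intro suminf_le U) auto
      also have "\<dots> = (\<Sum>i. outer (A i)) + (\<Sum>i. ennreal (e * (1/2) ^ Suc i))"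
        by (rule suminf_add[symmetric]) auto
      also have "(\<Sum>i. ennreal (e * (1/2) ^ Suc i)) = ennreal e"
      proof -
        have "(\<lambda>i. e * (1/2) ^ Suc i) sums (e * 1)"
          by (intro sums_mult power_half_series)
        then show ?thesis
          using \<open>0 < e\<close> by (intro suminf_ennreal_eq) auto
      qed
      finally show "outer (\<Union>i. A i) \<le> (\<Sum>i. outer (A i)) + ennreal e" .
    qed
  qed
qed

text \<open>It suffices to split open sets \<open>V\<close>. Their part in \<open>U\<close> is exhausted by compact sets \<open>C\<close>, and for each
of these the open set \<open>V - C\<close> covers the part outside \<open>U\<close> and is exhausted by compact sets disjoint
from \<open>C\<close>, on which the content is additive.\<close>

lemma open_Caratheodory:
  assumes U: "open U"
  shows "U \<in> lambda_system UNIV UNIV outer"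
proof -
  have alg: "algebra (UNIV :: 'b set) UNIV"
    using algebra_Pow[of "UNIV :: 'b set"] by simp
  have split: "outer (E \<inter> U) + outer (E - U) \<le> inner_content V" if V: "open V" "E \<subseteq> V" for E V
  proof -
    have 1: "compact_content C + outer (E - U) \<le> inner_content V" if C: "compact C" "C \<subseteq> V \<inter> U" "C \<subseteq> K" for C
    proof -
      have "compact_content C + compact_content D \<le> inner_content V" if D: "compact D" "D \<subseteq> V - C" "D \<subseteq> K" for D
      proof -
        have "compact_content C + compact_content D \<le> compact_content (C \<union> D)"
          using C D by (intro content_disjoint_Un) auto
        also have "\<dots> \<le> inner_content V"
          using C D by (intro inner_content_upper compact_Un) auto
        finally show ?thesis .
      qed
      then have "(SUP D\<in>{D. compact D \<and> D \<subseteq> (V - C) \<inter> K}. compact_content C + compact_content D) \<le> inner_content V"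
        by (intro SUP_least) auto
      then have "compact_content C + inner_content (V - C) \<le> inner_content V"
        unfolding inner_content_def[of "V - C"] by (subst ennreal_SUP_add_right) auto
      moreover have "outer (E - U) \<le> inner_content (V - C)"
        using V C by (intro outer_le open_Diff compact_imp_closed) auto
      ultimately show ?thesis
        by (meson add_left_mono order_trans)
    qed
    have "(SUP C\<in>{C. compact C \<and> C \<subseteq> (V \<inter> U) \<inter> K}. compact_content C + outer (E - U)) \<le> inner_content V"
      using 1 by (intro SUP_least) auto
    then have "inner_content (V \<inter> U) + outer (E - U) \<le> inner_content V"
      unfolding inner_content_def[of "V \<inter> U"] by (subst ennreal_SUP_add_left[symmetric]) auto
    moreover have "outer (E \<inter> U) \<le> inner_content (V \<inter> U)"
      using U V by (intro outer_le) auto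
    ultimately show ?thesis
      by (meson add_right_mono order_trans)
  qed
  have "outer (E \<inter> U) + outer (E - U) = outer E" for E
  proof (rule antisym)
    show "outer (E \<inter> U) + outer (E - U) \<le> outer E"
      unfolding outer_def[of E] using split by (intro INF_greatest) auto
    interpret sigma_algebra "UNIV :: 'b set" UNIV
      using sigma_algebra_Pow[of "UNIV :: 'b set"] by simp
    have "subadditive UNIV outer"
      using outer_measure_space_outer unfolding outer_measure_space_def
      by (intro countably_subadditive_subadditive) auto
    then have "outer ((E \<inter> U) \<union> (E - U)) \<le> outer (E \<inter> U) + outer (E - U)"
      unfolding subadditive_def by (metis UNIV_I Diff_disjoint Int_Diff Int_commute Int_empty_right)
    then show "outer E \<le> outer (E \<inter> U) + outer (E - U)"
      by (simp add: Int_Diff_Un)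
  qed
  then show ?thesis
    unfolding algebra.lambda_system_eq[OF alg] by blast
qed

definition Riesz_measure :: "'b measure" where
  "Riesz_measure = measure_of UNIV (sets borel) outer"

lemma sets_Riesz_measure [simp, measurable_cong]: "sets Riesz_measure = sets borel"
  unfolding Riesz_measure_def using sets.sets_measure_of_eq[of borel] by simp

lemma space_Riesz_measure [simp]: "space Riesz_measure = UNIV"
  unfolding Riesz_measure_def by (simp add: space_measure_of_conv)

lemma emeasure_Riesz_measure:
  assumes "B \<in> sets borel"
  shows "emeasure Riesz_measure B = outer B"
proof -
  interpret S: sigma_algebra "UNIV :: 'b set" UNIV
    using sigma_algebra_Pow[of "UNIV :: 'b set"] by simp
  have ms: "measure_space UNIV (lambda_system UNIV UNIV outer) outer"
    by (rule S.caratheodory_lemma[OF outer_measure_space_outer])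
  then interpret L: sigma_algebra UNIV "lambda_system UNIV UNIV outer"
    unfolding measure_space_def by blast
  have sub: "sets borel \<subseteq> lambda_system UNIV UNIV outer"
    unfolding sets_borel by (rule L.sigma_sets_subset) (use open_Caratheodory in auto)
  show ?thesis
    unfolding Riesz_measure_def
  proof (rule emeasure_measure_of_sigma)
    show "sigma_algebra UNIV (sets (borel :: 'b measure))"
      using sets.sigma_algebra_axioms[of "borel :: 'b measure"] by simp
    show "positive (sets borel) outer"
      using ms unfolding measure_space_def positive_def by blast
    show "countably_additive (sets borel) outer"
    proof (rule countably_additiveI)
      fix A :: "nat \<Rightarrow> 'b set"
      assume "range A \<subseteq> sets borel" "disjoint_family A" "\<Union> (range A) \<in> sets borel"
      then show "(\<Sum>i. outer (A i)) = outer (\<Union> (range A))"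
        using ms sub unfolding measure_space_def countably_additive_def by blast
    qed
  qed (rule assms)
qed

lemma K_borel [measurable]: "K \<in> sets borel"
  using compact_imp_closed[OF compact_K] by simp

abbreviation representing_measure :: "'b measure" where
  "representing_measure \<equiv> restrict_space Riesz_measure K"

lemma space_representing_measure [simp]: "space representing_measure = K"
  by (simp add: space_restrict_space)

lemma sets_representing_measure: "sets representing_measure = sets (restrict_space borel K)"
  by (rule sets_restrict_space_cong) simp

lemma mem_sets_representing_measure:
  "B \<in> sets representing_measure \<longleftrightarrow> B \<in> sets borel \<and> B \<subseteq> K"
  using sets_restrict_space_iff[of K Riesz_measure B] by auto

lemma emeasure_representing_measure:
  assumes "B \<in> sets borel" "B \<subseteq> K"
  shows "emeasure representing_measure B = outer B"
  using assms by (simp add: emeasure_restrict_space emeasure_Riesz_measure)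

sublocale representing: finite_measure representing_measure
  by (rule finite_measureI)
    (use outer_less_top[of K] in \<open>simp add: emeasure_representing_measure less_top[symmetric]\<close>)

text \<open>Outer regularity of the finite measure, applied to \<open>K - B\<close>, gives inner regularity at \<open>B\<close>: the
complement in \<open>K\<close> of an open set that covers \<open>K - B\<close> tightly is compact and fills \<open>B\<close>.\<close>

lemma representing_measure_inner_regular:
  assumes B: "B \<in> sets representing_measure"
  shows "emeasure representing_measure B =
    (SUP C\<in>{C. C \<subseteq> B \<and> compact C}. emeasure representing_measure C)"
proof (rule antisym)
  let ?N = representing_measure
  have B': "B \<in> sets borel" "B \<subseteq> K"
    using B by (auto simp: mem_sets_representing_measure)
  show "(SUP C\<in>{C. C \<subseteq> B \<and> compact C}. emeasure ?N C) \<le> emeasure ?N B"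
    using B by (intro SUP_least emeasure_mono) auto
  show "emeasure ?N B \<le> (SUP C\<in>{C. C \<subseteq> B \<and> compact C}. emeasure ?N C)"
  proof (rule ennreal_le_epsilon)
    fix e :: real assume "0 < e"
    obtain U where U: "open U" "K - B \<subseteq> U" "inner_content U \<le> outer (K - B) + ennreal e"
      using outer_approx[OF \<open>0 < e\<close>] .
    have KB: "K - B \<in> sets borel"
      using B' by measurable
    define C where "C = K - U"
    have C: "compact C" "C \<subseteq> B"
      unfolding C_def using compact_diff[OF compact_K U(1)] U(2) by auto
    have UB: "U - (K - B) \<in> sets borel" "U \<in> sets borel"
      using U(1) KB by auto
    have "outer (U - (K - B)) + outer (K - B) = outer U"
      using plus_emeasure[of "U - (K - B)" Riesz_measure "K - B"] UB KB U(2)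
      by (simp add: emeasure_Riesz_measure Un_absorb2 Int_commute)
    also have "\<dots> \<le> ennreal e + outer (K - B)"
      using U by (simp add: outer_open add.commute)
    finally have small: "outer (U - (K - B)) \<le> ennreal e"
      using outer_less_top[of "K - B"] by (auto simp: ennreal_add_left_cancel_le add.commute)
    have "emeasure ?N B \<le> emeasure ?N (C \<union> (B \<inter> U))"
      using B' C U(1) compact_imp_closed[OF C(1)] unfolding C_def
      by (intro emeasure_mono) (auto simp: mem_sets_representing_measure)
    also have "\<dots> \<le> emeasure ?N C + emeasure ?N (B \<inter> U)"
      using B' C U(1) compact_imp_closed[OF C(1)]
      by (intro emeasure_subadditive) (auto simp: mem_sets_representing_measure)
    also have "emeasure ?N (B \<inter> U) = outer (B \<inter> U)"
      using B' U(1) by (intro emeasure_representing_measure) auto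
    also have "\<dots> \<le> ennreal e"
      using B'(2) by (intro order_trans[OF outer_mono small]) auto
    also have "emeasure ?N C \<le> (SUP C\<in>{C. C \<subseteq> B \<and> compact C}. emeasure ?N C)"
      using C by (intro SUP_upper) auto
    finally show "emeasure ?N B \<le> (SUP C\<in>{C. C \<subseteq> B \<and> compact C}. emeasure ?N C) + ennreal e"
      by (simp add: add_left_mono add_right_mono)
  qed
qed

lemma radon_representing_measure: "radon_measure_on K representing_measure"
  unfolding radon_measure_on_def
proof (intro conjI ballI)
  fix x assume "x \<in> K"
  show "\<exists>U. open U \<and> x \<in> U \<and> emeasure representing_measure (U \<inter> K) < \<infinity>"
    using representing.emeasure_finite by (intro exI[of _ UNIV]) (auto simp: less_top[symmetric])
qed (use sets_representing_measure representing_measure_inner_regular in auto)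

lemma continuous_measurable:
  "continuous_on K f \<Longrightarrow> f \<in> borel_measurable representing_measure"
  using borel_measurable_continuous_on_restrict[of K f]
    measurable_cong_sets[OF sets_representing_measure refl] by blast

lemma continuous_integrable:
  fixes f :: "'b \<Rightarrow> real"
  assumes "continuous_on K f"
  shows "integrable representing_measure f"
proof -
  have "bounded (f ` K)"
    using compact_continuous_image[OF assms compact_K] by (rule compact_imp_bounded)
  then obtain b where "\<And>x. x \<in> K \<Longrightarrow> norm (f x) \<le> b"
    unfolding bounded_iff by auto
  then show ?thesis
    using continuous_measurable[OF assms]
    by (intro representing.integrable_const_bound[of _ b]) auto
qed

lemma sum_clip:
  fixes y :: real
  assumes "0 \<le> y"
  shows "(\<Sum>k<n. min 1 (max 0 (y - real k))) = min (real n) y"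
  using assms by (induction n) (auto simp: min_def max_def)

text \<open>A layer-cake argument. Cut \<open>n f\<close> into \<open>n\<close> layers \<open>c k\<close> of height 1. The layer \<open>c (k + 1)\<close> vanishes
off the compact level set of \<open>n f \<ge> k + 1\<close>, on which the layer below has the value 1; so its integral
is at most the measure of this set, and that is at most \<open>I (c k)\<close>. Summing loses only the bottom
layer, which contributes at most the total mass, independently of \<open>n\<close>.\<close>

lemma integral_le_of_unit_range:
  assumes f: "continuous_on K f" "\<And>x. x \<in> K \<Longrightarrow> 0 \<le> f x" "\<And>x. x \<in> K \<Longrightarrow> f x \<le> 1"
  shows "(\<integral>x. f x \<partial>representing_measure) \<le> I f"
proof -
  let ?N = representing_measure
  have bound: "real n * (\<integral>x. f x \<partial>?N) \<le> real n * I f + measure ?N K" for n :: nat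
  proof -
    define c where "c k x = min 1 (max 0 (real n * f x - real k))" for k :: nat and x
    have cont: "continuous_on K (c k)" for k
      unfolding c_def by (intro continuous_intros f(1))
    have level: "(\<integral>x. c (Suc k) x \<partial>?N) \<le> I (c k)" for k
    proof -
      define A where "A = {x \<in> K. real (Suc k) \<le> real n * f x}"
      have "closed A"
        unfolding A_def using compact_imp_closed[OF compact_K]
        by (intro continuous_on_closed_Collect_le continuous_intros f(1))
      have A: "A \<in> sets borel" "A \<subseteq> K"
        using \<open>closed A\<close> unfolding A_def by auto
      have maj: "majorant (c k) A"
        unfolding majorant_def using cont A by (auto simp: c_def A_def)
      have "ennreal (measure ?N A) = outer A"
        using A by (simp add: representing.emeasure_eq_measure[symmetric] emeasure_representing_measure)
      also have "\<dots> \<le> ennreal (I (c k))"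
        using outer_compact_le[OF A(2)] content_le[OF maj] by (rule order_trans)
      finally have "measure ?N A \<le> I (c k)"
        using majorant_nonneg[OF maj] by simp
      moreover have "(\<integral>x. c (Suc k) x \<partial>?N) \<le> (\<integral>x. indicator A x \<partial>?N)"
      proof (rule integral_mono)
        show "integrable ?N (indicat_real A)"
          using A by (intro integrable_real_indicator)
            (auto simp: mem_sets_representing_measure less_top[symmetric] representing.emeasure_finite)
        show "c (Suc k) x \<le> indicator A x" if "x \<in> space ?N" for x
          using that unfolding c_def A_def by (auto simp: indicator_def)
      qed (rule continuous_integrable[OF cont])
      moreover have "(\<integral>x. indicator A x \<partial>?N) = measure ?N A"
        using A by (simp add: Int_absorb2)
      ultimately show ?thesis
        by simp
    qed
    have y: "0 \<le> real n * f x" "real n * f x \<le> real n" if "x \<in> K" for x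
      using f(2,3)[OF that] by (auto simp: mult_left_le)
    have sum_c: "(\<Sum>k<n. c k x) = real n * f x" if "x \<in> K" for x
      unfolding c_def using sum_clip[OF y(1)[OF that], of n] y(2)[OF that] by simp
    have sum_c_Suc: "real n * f x - 1 \<le> (\<Sum>k<n. c (Suc k) x)" if "x \<in> K" for x
    proof -
      have "(\<Sum>k<Suc n. c k x) = real n * f x"
        unfolding c_def using sum_clip[OF y(1)[OF that], of "Suc n"] y(2)[OF that] by simp
      then have "c 0 x + (\<Sum>k<n. c (Suc k) x) = real n * f x"
        by (simp only: sum.lessThan_Suc_shift)
      moreover have "c 0 x \<le> 1"
        unfolding c_def by simp
      ultimately show ?thesis
        by linarith
    qed
    have "real n * (\<integral>x. f x \<partial>?N) - measure ?N K = (\<integral>x. real n * f x - 1 \<partial>?N)"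
      using continuous_integrable[OF f(1)] by (simp add: Bochner_Integration.integral_diff)
    also have "\<dots> \<le> (\<integral>x. (\<Sum>k<n. c (Suc k) x) \<partial>?N)"
      by (rule integral_mono)
        (auto intro!: continuous_integrable continuous_intros f(1) cont sum_c_Suc)
    also have "\<dots> = (\<Sum>k<n. \<integral>x. c (Suc k) x \<partial>?N)"
      by (rule Bochner_Integration.integral_sum) (rule continuous_integrable[OF cont])
    also have "\<dots> \<le> (\<Sum>k<n. I (c k))"
      by (rule sum_mono) (rule level)
    also have "\<dots> = I (\<lambda>x. \<Sum>k<n. c k x)"
      by (rule sum[OF cont, symmetric])
    also have "\<dots> = I (\<lambda>x. real n * f x)"
      by (rule cong) (auto intro!: continuous_intros cont f(1) sum_c)
    also have "\<dots> = real n * I f"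
      by (rule scale[OF f(1)])
    finally show ?thesis
      by simp
  qed
  show ?thesis
  proof (rule ccontr)
    assume "\<not> ?thesis"
    then have gap: "(\<integral>x. f x \<partial>?N) - I f > 0"
      by simp
    obtain n :: nat where "measure ?N K / ((\<integral>x. f x \<partial>?N) - I f) < real n"
      using reals_Archimedean2 by blast
    then have "measure ?N K < real n * ((\<integral>x. f x \<partial>?N) - I f)"
      using gap by (simp add: divide_less_eq)
    then show False
      using bound[of n] by (simp add: algebra_simps)
  qed
qed

lemma I_one_le_measure: "I (\<lambda>x. 1) \<le> measure representing_measure K"
proof -
  have "ennreal (I (\<lambda>x. 1)) \<le> compact_content K"
    unfolding compact_content_def majorant_def by (auto intro!: INF_greatest ennreal_leI mono)
  also have "\<dots> \<le> outer K"
    unfolding outer_def using compact_K by (auto intro!: INF_greatest inner_content_upper)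
  also have "\<dots> = ennreal (measure representing_measure K)"
    by (simp add: representing.emeasure_eq_measure[symmetric] emeasure_representing_measure)
  finally show ?thesis
    by simp
qed

text \<open>The inequality between integral and functional, applied to \<open>g\<close> and to \<open>1 - g\<close>, is an equality because
the total mass is at least \<open>I 1\<close>. Continuous functions on \<open>K\<close> are bounded and reduce to the range
from 0 to 1 by an affine change.\<close>

theorem integral_representing_measure:
  assumes f: "continuous_on K f"
  shows "(\<integral>x. f x \<partial>representing_measure) = I f"
proof -
  let ?N = representing_measure
  have unit: "(\<integral>x. g x \<partial>?N) = I g"
    if g: "continuous_on K g" "\<And>x. x \<in> K \<Longrightarrow> 0 \<le> g x" "\<And>x. x \<in> K \<Longrightarrow> g x \<le> 1" for g
  proof (rule antisym)
    show "(\<integral>x. g x \<partial>?N) \<le> I g"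
      by (rule integral_le_of_unit_range[OF g])
    have "(\<integral>x. 1 - g x \<partial>?N) \<le> I (\<lambda>x. 1 - g x)"
      using g by (intro integral_le_of_unit_range) (auto intro!: continuous_intros)
    also have "\<dots> = I (\<lambda>x. 1) - I g"
      by (rule diff) (auto intro: g)
    also have "(\<integral>x. 1 - g x \<partial>?N) = measure ?N K - (\<integral>x. g x \<partial>?N)"
      using continuous_integrable[OF g(1)] by simp
    finally show "I g \<le> (\<integral>x. g x \<partial>?N)"
      using I_one_le_measure by linarith
  qed
  have "bounded (f ` K)"
    using compact_continuous_image[OF f compact_K] by (rule compact_imp_bounded)
  then obtain b where b: "b > 0" "\<And>x. x \<in> K \<Longrightarrow> \<bar>f x\<bar> \<le> b"
    unfolding bounded_pos by auto
  define g where "g x = (f x + b) / (2 * b)" for x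
  have cg: "continuous_on K g"
    unfolding g_def using b(1) by (intro continuous_intros f) auto
  have "0 \<le> g x" "g x \<le> 1" if "x \<in> K" for x
    using b(2)[OF that] b(1) unfolding g_def by (auto simp: field_simps)
  then have "(\<integral>x. g x \<partial>?N) = I g"
    using unit cg by blast
  moreover have "(\<integral>x. 1 \<partial>?N) = I (\<lambda>x. 1)"
    by (rule unit) auto
  moreover have f_eq: "f = (\<lambda>x. 2 * b * g x - b)"
    unfolding g_def using b(1) by auto
  moreover have "I (\<lambda>x. 2 * b * g x - b) = 2 * b * I g - b * I (\<lambda>x. 1)"
    using cg const[of b] by (simp add: diff scale continuous_intros)
  moreover have "(\<integral>x. 2 * b * g x - b \<partial>?N) = 2 * b * (\<integral>x. g x \<partial>?N) - b * (\<integral>x. 1 \<partial>?N)"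
    using continuous_integrable[OF cg] by simp
  ultimately show ?thesis
    by simp
qed

end

section \<open>Integral representation on the space of characters\<close>

text \<open>The approximation theorem of Stone and Weierstrass and the measure construction above require
a Hausdorff type, and the product topology on functions with Hausdorff values is Hausdorff whatever
the domain. The weaker separation classes come first, because an instance of a class needs instances
of its superclasses that are at least as general.\<close>

instance "fun" :: (type, t0_space) t0_space
proof
  fix f g :: "'a \<Rightarrow> 'b"
  assume "f \<noteq> g"
  then obtain x where "f x \<noteq> g x"
    by blast
  then obtain U where "open U" "\<not> (f x \<in> U \<longleftrightarrow> g x \<in> U)"
    using t0_space_class.t0_space[OF \<open>f x \<noteq> g x\<close>] by blast
  then show "\<exists>U. open U \<and> \<not> (f \<in> U \<longleftrightarrow> g \<in> U)"
    by (intro exI[of _ "(\<lambda>h. h x) -` U"]) (auto intro!: open_vimage)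
qed

instance "fun" :: (type, t1_space) t1_space
proof
  fix f g :: "'a \<Rightarrow> 'b"
  assume "f \<noteq> g"
  then obtain x where "f x \<noteq> g x"
    by blast
  then obtain U where "open U" "f x \<in> U" "g x \<notin> U"
    using t1_space_class.t1_space[OF \<open>f x \<noteq> g x\<close>] by blast
  then show "\<exists>U. open U \<and> f \<in> U \<and> g \<notin> U"
    by (intro exI[of _ "(\<lambda>h. h x) -` U"]) (auto intro!: open_vimage)
qed

instance "fun" :: (type, t2_space) t2_space
proof
  fix f g :: "'a \<Rightarrow> 'b"
  assume "f \<noteq> g"
  then obtain x where "f x \<noteq> g x"
    by blast
  then obtain U V where "open U" "open V" "f x \<in> U" "g x \<in> V" "U \<inter> V = {}"
    using hausdorff[OF \<open>f x \<noteq> g x\<close>] by blast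
  then show "\<exists>U V. open U \<and> open V \<and> f \<in> U \<and> g \<in> V \<and> U \<inter> V = {}"
    by (intro exI[of _ "(\<lambda>h. h x) -` U"] exI[of _ "(\<lambda>h. h x) -` V"])
       (auto intro!: open_vimage)
qed

lemma closed_character_space:
  "closed (character_space :: ('a::real_algebra_1 \<Rightarrow> real) set)"
proof -
  have "character_space = {\<alpha> :: 'a \<Rightarrow> real. (\<forall>a b. \<alpha> (a + b) = \<alpha> a + \<alpha> b) \<and>
      (\<forall>c a. \<alpha> (c *\<^sub>R a) = c * \<alpha> a) \<and> \<alpha> 1 = 1 \<and> (\<forall>a b. \<alpha> (a * b) = \<alpha> a * \<alpha> b)}"
    unfolding character_space_def linear_iff by auto
  also have "closed \<dots>"
    by (intro closed_Collect_conj closed_Collect_all closed_Collect_eq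
        continuous_intros continuous_on_product_coordinates)
  finally show ?thesis .
qed

text \<open>The elements whose values are bounded uniformly over these characters form a subalgebra that
contains the generators, so every element has such a bound. The set is therefore a closed subset of a
product of compact intervals.\<close>

lemma compact_bounded_characters:
  fixes G :: "'a::{real_algebra_1, comm_ring_1} set"
  assumes "generates_algebra G"
  shows "compact {\<alpha> \<in> character_space. \<forall>a\<in>G. \<bar>\<alpha> a\<bar> \<le> \<delta> a}" (is "compact ?K")
proof -
  define B where "B = {a. \<exists>c. \<forall>\<alpha>\<in>?K. \<bar>\<alpha> a\<bar> \<le> c}"
  have ch: "\<alpha> (x + y) = \<alpha> x + \<alpha> y" "\<alpha> (r *\<^sub>R x) = r * \<alpha> x" "\<alpha> 1 = 1" "\<alpha> (x * y) = \<alpha> x * \<alpha> y" "\<alpha> 0 = 0"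
    if "\<alpha> \<in> ?K" for \<alpha> x y r
    using that linear_0[of \<alpha>] unfolding character_space_def linear_iff by auto
  have "x + y \<in> B \<and> x * y \<in> B" if xy: "x \<in> B" "y \<in> B" for x y
  proof -
    obtain c d where c: "\<And>\<alpha>. \<alpha> \<in> ?K \<Longrightarrow> \<bar>\<alpha> x\<bar> \<le> c" and d: "\<And>\<alpha>. \<alpha> \<in> ?K \<Longrightarrow> \<bar>\<alpha> y\<bar> \<le> d"
      using xy unfolding B_def by blast
    have "\<bar>\<alpha> (x + y)\<bar> \<le> c + d" "\<bar>\<alpha> (x * y)\<bar> \<le> c * d" if "\<alpha> \<in> ?K" for \<alpha>
      using c[OF that] d[OF that] by (auto simp only: ch[OF that] abs_mult intro!: mult_mono)
    then show ?thesis
      unfolding B_def by blast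
  qed
  moreover have "r *\<^sub>R x \<in> B" if x: "x \<in> B" for r x
  proof -
    obtain c where c: "\<And>\<alpha>. \<alpha> \<in> ?K \<Longrightarrow> \<bar>\<alpha> x\<bar> \<le> c"
      using x unfolding B_def by blast
    have "\<bar>\<alpha> (r *\<^sub>R x)\<bar> \<le> \<bar>r\<bar> * c" if "\<alpha> \<in> ?K" for \<alpha>
      using c[OF that] by (simp only: ch[OF that] abs_mult mult_left_mono abs_ge_zero)
    then show ?thesis
      unfolding B_def by blast
  qed
  moreover have "0 \<in> B" "1 \<in> B"
  proof -
    have "\<bar>\<alpha> 0\<bar> \<le> 0" "\<bar>\<alpha> 1\<bar> \<le> 1" if "\<alpha> \<in> ?K" for \<alpha>
      unfolding ch(3,5)[OF that] by simp_all
    then show "0 \<in> B" "1 \<in> B"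
      unfolding B_def by blast+
  qed
  ultimately have "real_subalgebra B"
    unfolding real_subalgebra_def subspace_def by blast
  moreover have "G \<subseteq> B"
    unfolding B_def by blast
  ultimately have "B = UNIV"
    using assms hull_minimal[of G B real_subalgebra] unfolding generates_algebra_def by auto
  then have "\<exists>c. \<forall>\<alpha>\<in>?K. \<bar>\<alpha> a\<bar> \<le> c" for a
    unfolding B_def by blast
  then obtain c where c: "\<And>a. \<forall>\<alpha>\<in>?K. \<bar>\<alpha> a\<bar> \<le> c a"
    using choice[of "\<lambda>a c. \<forall>\<alpha>\<in>?K. \<bar>\<alpha> a\<bar> \<le> c"] by blast
  have "compact (PiE UNIV (\<lambda>a. {- c a..c a}))"
    using compactin_PiE[of "\<lambda>_. euclidean" UNIV "\<lambda>a. {- c a..c a}"]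
    by (simp add: euclidean_product_topology)
  moreover have "closed ?K"
  proof -
    have "closed {\<alpha> :: 'a \<Rightarrow> real. \<forall>a\<in>G. \<bar>\<alpha> a\<bar> \<le> \<delta> a}"
      unfolding Ball_def
      by (intro closed_Collect_all closed_Collect_imp closed_Collect_le
          continuous_intros continuous_on_product_coordinates) simp
    then have "closed (character_space \<inter> {\<alpha>. \<forall>a\<in>G. \<bar>\<alpha> a\<bar> \<le> \<delta> a})"
      by (rule closed_Int[OF closed_character_space])
    also have "character_space \<inter> {\<alpha>. \<forall>a\<in>G. \<bar>\<alpha> a\<bar> \<le> \<delta> a} = ?K"
      by blast
    finally show ?thesis .
  qed
  ultimately have "compact (?K \<inter> PiE UNIV (\<lambda>a. {- c a..c a}))"
    by (intro closed_Int_compact)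
  moreover have "?K \<subseteq> PiE UNIV (\<lambda>a. {- c a..c a})"
    using c by (auto simp: abs_le_iff minus_le_iff)
  ultimately show ?thesis
    by (simp add: Int_absorb2)
qed

text \<open>Used to pass from approximation up to multiples of an arbitrary error to exact relations.\<close>

lemma le_zero_of_le_multiples:
  fixes x C :: real
  assumes "\<And>e. e > 0 \<Longrightarrow> x \<le> e * C"
  shows "x \<le> 0"
proof (rule field_le_epsilon)
  fix e :: real assume "e > 0"
  then have "x \<le> e / (\<bar>C\<bar> + 1) * C"
    by (intro assms) (simp add: add_nonneg_pos)
  also have "\<dots> \<le> e"
    using \<open>e > 0\<close> by (simp add: divide_le_eq add_nonneg_pos)
  finally show "x \<le> 0 + e"
    by simp
qed

text \<open>The algebra acts on \<open>K\<close> by evaluation, with a point-separating and hence uniformly dense image in the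
continuous functions. A functional that is positive for the order on \<open>K\<close> is Lipschitz with constant
\<open>L 1\<close> for the uniform distance, so it extends. The explicit extension is the infimum of \<open>L\<close> over the
elements dominating \<open>f\<close>; all its properties follow from its distance to the values of \<open>L\<close> at
approximants of \<open>f\<close>.\<close>

lemma extend_to_continuous_functions:
  fixes L :: "'a::{real_algebra_1, comm_ring_1} \<Rightarrow> real"
  assumes K: "compact K" "K \<subseteq> character_space" and lin: "linear L"
    and pos: "\<And>a. (\<And>\<alpha>. \<alpha> \<in> K \<Longrightarrow> 0 \<le> \<alpha> a) \<Longrightarrow> 0 \<le> L a"
  shows "\<exists>I. positive_functional K I \<and> (\<forall>a. I (\<lambda>\<alpha>. \<alpha> a) = L a)"
proof -
  have ch: "\<alpha> (x + y) = \<alpha> x + \<alpha> y" "\<alpha> (x - y) = \<alpha> x - \<alpha> y" "\<alpha> (of_real r) = r"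
    "\<alpha> (x * y) = \<alpha> x * \<alpha> y" if "\<alpha> \<in> K" for \<alpha> x y r
    using characterD[of \<alpha>] that K(2) linear_add linear_diff by (blast, metis subsetD, auto)
  have L: "L (x + y) = L x + L y" "L (x - y) = L x - L y" "L (of_real r * x) = r * L x" "L (of_real r) = r * L 1" for x y r
    using linear_add[OF lin] linear_diff[OF lin] linear_of_real_mult[OF lin, of r x]
      linear_of_real_mult[OF lin, of r 1] by simp_all
  have L1: "0 \<le> L 1"
    using pos[of 1] ch(3)[of _ 1] by simp
  define close where "close f e a \<longleftrightarrow> (\<forall>\<alpha>\<in>K. \<bar>f \<alpha> - \<alpha> a\<bar> \<le> e)" for f :: "('a \<Rightarrow> real) \<Rightarrow> real" and e a
  define I where "I f = Inf {L b |b. \<forall>\<alpha>\<in>K. f \<alpha> \<le> \<alpha> b}" for f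
  have close_I: "\<bar>I f - L a\<bar> \<le> e * L 1" if cl: "close f e a" for f e a
  proof -
    let ?S = "{L b |b. \<forall>\<alpha>\<in>K. f \<alpha> \<le> \<alpha> b}"
    have lower: "L a - e * L 1 \<le> s" if "s \<in> ?S" for s
    proof -
      obtain b where b: "s = L b" "\<And>\<alpha>. \<alpha> \<in> K \<Longrightarrow> f \<alpha> \<le> \<alpha> b"
        using \<open>s \<in> ?S\<close> by blast
      have "0 \<le> \<alpha> (b - (a - of_real e))" if "\<alpha> \<in> K" for \<alpha>
      proof -
        have "\<bar>f \<alpha> - \<alpha> a\<bar> \<le> e"
          using cl that unfolding close_def by blast
        then show ?thesis
          using b(2)[OF that] unfolding ch[OF that] by linarith
      qed
      then have "0 \<le> L (b - (a - of_real e))"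
        by (rule pos)
      then show ?thesis
        unfolding b(1) L by simp
    qed
    have "\<forall>\<alpha>\<in>K. f \<alpha> \<le> \<alpha> (a + of_real e)"
      using cl unfolding close_def by (fastforce simp: ch abs_le_iff)
    then have mem: "L (a + of_real e) \<in> ?S"
      by blast
    have "I f \<le> L (a + of_real e)"
      unfolding I_def by (rule cInf_lower[OF mem]) (rule bdd_belowI[OF lower])
    moreover have "L a - e * L 1 \<le> I f"
      unfolding I_def using mem lower by (intro cInf_greatest) auto
    ultimately show ?thesis
      unfolding L by linarith
  qed
  have dense: "\<exists>a. close f e a" if "continuous_on K f" "e > 0" for f e
  proof -
    \<comment> \<open>Only the values on \<open>K\<close> are prescribed, since the evaluation of a constant is constant only on
      characters.\<close>
    let ?P = "\<lambda>f. \<exists>a. \<forall>\<alpha>\<in>K. f \<alpha> = \<alpha> a"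
    have "\<exists>g. ?P g \<and> (\<forall>\<alpha>\<in>K. \<bar>f \<alpha> - g \<alpha>\<bar> < e)"
    proof (rule Stone_Weierstrass_HOL[OF K(1) _ _ _ _ _ that])
      show "?P (\<lambda>\<alpha>. c)" for c
        by (rule exI[of _ "of_real c"]) (simp add: ch)
      show "continuous_on K g" if "?P g" for g
      proof -
        obtain a where "\<And>\<alpha>. \<alpha> \<in> K \<Longrightarrow> g \<alpha> = \<alpha> a"
          using \<open>?P g\<close> by blast
        then show ?thesis
          using continuous_on_subset[OF continuous_on_product_coordinates, of K a]
          by (simp cong: continuous_on_cong)
      qed
      show "?P (\<lambda>\<alpha>. g \<alpha> + h \<alpha>)" "?P (\<lambda>\<alpha>. g \<alpha> * h \<alpha>)" if gh: "?P g \<and> ?P h" for g h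
      proof -
        obtain a b where "\<And>\<alpha>. \<alpha> \<in> K \<Longrightarrow> g \<alpha> = \<alpha> a" "\<And>\<alpha>. \<alpha> \<in> K \<Longrightarrow> h \<alpha> = \<alpha> b"
          using gh by blast
        then show "?P (\<lambda>\<alpha>. g \<alpha> + h \<alpha>)" "?P (\<lambda>\<alpha>. g \<alpha> * h \<alpha>)"
          by (auto simp: ch intro: exI[of _ "a + b"] exI[of _ "a * b"])
      qed
      show "\<exists>f. ?P f \<and> f \<alpha> \<noteq> f \<beta>" if ne: "\<alpha> \<in> K \<and> \<beta> \<in> K \<and> \<alpha> \<noteq> \<beta>" for \<alpha> \<beta>
      proof -
        obtain a where "\<alpha> a \<noteq> \<beta> a"
          using ne by blast
        then show ?thesis
          by (intro exI[of _ "\<lambda>\<gamma>. \<gamma> a"]) auto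
      qed
    qed
    then obtain g a where "\<forall>\<alpha>\<in>K. g \<alpha> = \<alpha> a" "\<forall>\<alpha>\<in>K. \<bar>f \<alpha> - g \<alpha>\<bar> < e"
      by blast
    then have "close f e a"
      unfolding close_def by (simp add: less_imp_le)
    then show ?thesis
      by blast
  qed
  have "positive_functional K I"
  proof
    show "compact K"
      by (rule K)
  next
    fix f g :: "('a \<Rightarrow> real) \<Rightarrow> real"
    assume f: "continuous_on K f" and g: "continuous_on K g"
    have "\<bar>I (\<lambda>\<alpha>. f \<alpha> + g \<alpha>) - (I f + I g)\<bar> \<le> 0"
    proof (rule le_zero_of_le_multiples)
      fix e :: real assume "e > 0"
      obtain a b where a: "close f e a" and b: "close g e b"
        using dense f g \<open>e > 0\<close> by meson
      have "close (\<lambda>\<alpha>. f \<alpha> + g \<alpha>) (2 * e) (a + b)"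
        unfolding close_def
      proof
        fix \<alpha> assume \<alpha>: "\<alpha> \<in> K"
        then have "\<bar>f \<alpha> - \<alpha> a\<bar> \<le> e" "\<bar>g \<alpha> - \<alpha> b\<bar> \<le> e"
          using a b unfolding close_def by auto
        then show "\<bar>f \<alpha> + g \<alpha> - \<alpha> (a + b)\<bar> \<le> 2 * e"
          unfolding ch[OF \<alpha>] by linarith
      qed
      from close_I[OF this] close_I[OF a] close_I[OF b]
      show "\<bar>I (\<lambda>\<alpha>. f \<alpha> + g \<alpha>) - (I f + I g)\<bar> \<le> e * (4 * L 1)"
        unfolding L by linarith
    qed
    then show "I (\<lambda>\<alpha>. f \<alpha> + g \<alpha>) = I f + I g"
      by simp
  next
    fix f :: "('a \<Rightarrow> real) \<Rightarrow> real" and c :: real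
    assume f: "continuous_on K f"
    have "\<bar>I (\<lambda>\<alpha>. c * f \<alpha>) - c * I f\<bar> \<le> 0"
    proof (rule le_zero_of_le_multiples)
      fix e :: real assume "e > 0"
      obtain a where a: "close f e a"
        using dense f \<open>e > 0\<close> by meson
      have "close (\<lambda>\<alpha>. c * f \<alpha>) (\<bar>c\<bar> * e) (of_real c * a)"
        unfolding close_def
      proof
        fix \<alpha> assume \<alpha>: "\<alpha> \<in> K"
        then have "\<bar>c\<bar> * \<bar>f \<alpha> - \<alpha> a\<bar> \<le> \<bar>c\<bar> * e"
          using a unfolding close_def by (auto intro: mult_left_mono)
        then show "\<bar>c * f \<alpha> - \<alpha> (of_real c * a)\<bar> \<le> \<bar>c\<bar> * e"
          unfolding ch[OF \<alpha>] by (simp flip: abs_mult right_diff_distrib)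
      qed
      from close_I[OF this] have "\<bar>I (\<lambda>\<alpha>. c * f \<alpha>) - c * L a\<bar> \<le> \<bar>c\<bar> * e * L 1"
        unfolding L .
      moreover have "\<bar>c * I f - c * L a\<bar> \<le> \<bar>c\<bar> * (e * L 1)"
        using mult_left_mono[OF close_I[OF a], of "\<bar>c\<bar>"] by (simp flip: abs_mult right_diff_distrib)
      ultimately show "\<bar>I (\<lambda>\<alpha>. c * f \<alpha>) - c * I f\<bar> \<le> e * (2 * \<bar>c\<bar> * L 1)"
        by (simp add: mult_ac)
    qed
    then show "I (\<lambda>\<alpha>. c * f \<alpha>) = c * I f"
      by simp
  next
    fix f :: "('a \<Rightarrow> real) \<Rightarrow> real"
    assume f: "continuous_on K f" and nn: "\<And>\<alpha>. \<alpha> \<in> K \<Longrightarrow> 0 \<le> f \<alpha>"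
    have "- I f \<le> 0"
    proof (rule le_zero_of_le_multiples)
      fix e :: real assume "e > 0"
      obtain a where a: "close f e a"
        using dense f \<open>e > 0\<close> by meson
      have "0 \<le> L (a + of_real e)"
      proof (rule pos)
        fix \<alpha> assume \<alpha>: "\<alpha> \<in> K"
        then have "\<bar>f \<alpha> - \<alpha> a\<bar> \<le> e"
          using a unfolding close_def by auto
        then show "0 \<le> \<alpha> (a + of_real e)"
          using nn[OF \<alpha>] unfolding ch[OF \<alpha>] by linarith
      qed
      then show "- I f \<le> e * (2 * L 1)"
        using close_I[OF a] unfolding L by linarith
    qed
    then show "0 \<le> I f"
      by simp
  qed
  moreover have "I (\<lambda>\<alpha>. \<alpha> a) = L a" for a
    using close_I[of "\<lambda>\<alpha>. \<alpha> a" 0 a] unfolding close_def by simp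
  ultimately have "positive_functional K I \<and> (\<forall>a. I (\<lambda>\<alpha>. \<alpha> a) = L a)"
    by (intro conjI allI)
  then show ?thesis
    by (intro exI[of _ I])
qed

theorem theorem4p1:
  fixes G :: "'a::{real_algebra_1, comm_ring_1} set"
    and \<delta> :: "'a \<Rightarrow> real"
    and L :: "'a \<Rightarrow> real"
    and K :: "('a \<Rightarrow> real) set"
  assumes "(character_space :: ('a \<Rightarrow> real) set) \<noteq> {}"
    and "generates_algebra G"
    and "\<forall>a\<in>G. \<delta> a > 0"
  defines "K \<equiv> {\<alpha> \<in> character_space. \<forall>a\<in>G. \<bar>\<alpha> a\<bar> \<le> \<delta> a}"
  shows "(linear L \<and> psd_functional L \<and>
            (\<exists>\<gamma> :: 'a \<Rightarrow> real. (\<forall>a\<in>G. \<gamma> a > 0) \<and>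
               (\<forall>n\<ge>1. \<forall>a\<in>G. L (a ^ (2 * n)) \<le> \<gamma> a * \<delta> a ^ (2 * n))))
         \<longleftrightarrow>
         (\<exists>\<mu>. radon_measure_on K \<mu> \<and>
            (\<forall>a. integrable \<mu> (\<lambda>\<alpha>. \<alpha> a) \<and> L a = (\<integral>\<alpha>. \<alpha> a \<partial>\<mu>)))"
    (is "?moments \<longleftrightarrow> ?measure")
proof
  assume ?moments
  then obtain \<gamma> where lin: "linear L" and psd: "psd_functional L"
    and \<gamma>: "\<And>n a. n \<ge> 1 \<Longrightarrow> a \<in> G \<Longrightarrow> L (a ^ (2 * n)) \<le> \<gamma> a * \<delta> a ^ (2 * n)"
    by blast
  have \<delta>: "\<And>a. a \<in> G \<Longrightarrow> \<delta> a > 0"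
    using assms(3) by blast
  \<comment> \<open>The growth condition starts at \<open>n = 1\<close>; enlarging the factor to at least \<open>L 1\<close> includes \<open>n = 0\<close>.\<close>
  have growth: "L (a ^ (2 * n)) \<le> max (\<gamma> a) (L 1) * \<delta> a ^ (2 * n)" if "a \<in> G" for n a
  proof (cases "n = 0")
    case False
    then have "L (a ^ (2 * n)) \<le> \<gamma> a * \<delta> a ^ (2 * n)"
      using \<gamma> \<open>a \<in> G\<close> by simp
    also have "\<dots> \<le> max (\<gamma> a) (L 1) * \<delta> a ^ (2 * n)"
      using \<delta>[OF \<open>a \<in> G\<close>] by (intro mult_right_mono) auto
    finally show ?thesis .
  qed simp
  have L: "moment_bounded G \<delta> L"
    unfolding moment_bounded_def using lin psd growth by blast
  have pos: "0 \<le> L a" if "\<And>\<alpha>. \<alpha> \<in> K \<Longrightarrow> 0 \<le> \<alpha> a" for a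
    using that unfolding K_def by (intro moment_bounded_nonneg[OF L assms(2) \<delta>]) auto
  have "compact K" "K \<subseteq> character_space"
    unfolding K_def using compact_bounded_characters[OF assms(2)] by auto
  then have "\<exists>I. positive_functional K I \<and> (\<forall>a. I (\<lambda>\<alpha>. \<alpha> a) = L a)"
    by (rule extend_to_continuous_functions[OF _ _ lin pos])
  then obtain I where I: "positive_functional K I \<and> (\<forall>a. I (\<lambda>\<alpha>. \<alpha> a) = L a)"
    by (rule exE)
  interpret positive_functional K I
    using I by (rule conjunct1)
  have cont: "continuous_on K (\<lambda>\<alpha>. \<alpha> a)" for a
    by (rule continuous_on_subset[OF continuous_on_product_coordinates]) simp
  show ?measure
    using radon_representing_measure continuous_integrable[OF cont]
      integral_representing_measure[OF cont] I
    by (intro exI[of _ representing_measure]) simp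
next
  assume ?measure
  then obtain \<mu> where \<mu>: "radon_measure_on K \<mu>" and int: "\<And>a. integrable \<mu> (\<lambda>\<alpha>. \<alpha> a)"
    and L: "\<And>a. L a = (\<integral>\<alpha>. \<alpha> a \<partial>\<mu>)"
    by blast
  have "space \<mu> = space (restrict_space borel K)"
    using \<mu> unfolding radon_measure_on_def by (intro sets_eq_imp_space_eq) blast
  then have space: "space \<mu> = K"
    by (simp add: space_restrict_space)
  have ch: "linear \<alpha>" "\<alpha> 1 = 1" "\<alpha> (x * y) = \<alpha> x * \<alpha> y" "\<alpha> (x ^ n) = \<alpha> x ^ n" if "\<alpha> \<in> space \<mu>" for \<alpha> x y n
    using characterD[of \<alpha>] that unfolding space K_def by auto
  have "linear L"
  proof (rule linearI)
    fix x y c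
    have "L (x + y) = (\<integral>\<alpha>. \<alpha> x + \<alpha> y \<partial>\<mu>)"
      unfolding L by (rule Bochner_Integration.integral_cong) (auto simp: linear_add[OF ch(1)])
    also have "\<dots> = L x + L y"
      unfolding L by (rule Bochner_Integration.integral_add[OF int int])
    finally show "L (x + y) = L x + L y" .
    have "L (c *\<^sub>R x) = (\<integral>\<alpha>. c *\<^sub>R \<alpha> x \<partial>\<mu>)"
      unfolding L by (rule Bochner_Integration.integral_cong) (auto simp: linear_scale[OF ch(1)])
    also have "\<dots> = c *\<^sub>R L x"
      unfolding L by (rule Bochner_Integration.integral_scaleR_right)
    finally show "L (c *\<^sub>R x) = c *\<^sub>R L x" .
  qed
  moreover have "psd_functional L"
    unfolding psd_functional_def L by (auto intro!: integral_nonneg_AE simp: ch(4))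
  \<comment> \<open>The natural factor is the total mass \<open>L 1\<close>; adding 1 makes it positive when the measure vanishes.\<close>
  moreover have "L (a ^ (2 * n)) \<le> (L 1 + 1) * \<delta> a ^ (2 * n)" if a: "a \<in> G" for n a
  proof -
    have "L (a ^ (2 * n)) \<le> (\<integral>\<alpha>. \<delta> a ^ (2 * n) * \<alpha> 1 \<partial>\<mu>)"
      unfolding L
    proof (rule integral_mono)
      show "integrable \<mu> (\<lambda>\<alpha>. \<delta> a ^ (2 * n) * \<alpha> 1)"
        using int by simp
      fix \<alpha> assume \<alpha>: "\<alpha> \<in> space \<mu>"
      then have "\<bar>\<alpha> a\<bar> \<le> \<delta> a"
        using a unfolding space K_def by blast
      then have "\<bar>\<alpha> a\<bar> ^ (2 * n) \<le> \<delta> a ^ (2 * n)"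
        by (intro power_mono) auto
      then show "\<alpha> (a ^ (2 * n)) \<le> \<delta> a ^ (2 * n) * \<alpha> 1"
        by (simp add: ch[OF \<alpha>] power_even_abs)
    qed (rule int)
    also have "\<dots> = \<delta> a ^ (2 * n) * L 1"
      unfolding L by simp
    also have "\<dots> \<le> (L 1 + 1) * \<delta> a ^ (2 * n)"
      using assms(3) a by (simp add: algebra_simps less_imp_le)
    finally show ?thesis .
  qed
  moreover have "L 1 \<ge> 0"
    unfolding L by (intro integral_nonneg_AE) (auto simp: ch(2))
  ultimately show ?moments
    by (intro conjI exI[of _ "\<lambda>_. L 1 + 1"]) auto
qed

end
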